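(* Let $n\ge1$ be an integer, $T\in\mathbb{R}$, and let $u\in\mathcal{D}^0(\mathbb{R}^n)\cap L^1_0(\mathbb{R}^n)$ be a solution of $$\mathcal{L}_\Delta u+Tu=\tfrac4n u\ln u,\qquad u\ge0\quad\text{in }\mathbb{R}^n. \qquad (\ast)$$ (i) Given $l>0$ and $x_0\in\mathbb{R}^n$, let $v_l(x)=l\,u(x+x_0)$ for $x\in\mathbb{R}^n$. Then $$\mathcal{L}_\Delta v_l+\big(T+\tfrac4n\ln l\big)v_l=\tfrac4n v_l\ln v_l,\qquad v_l\ge0\quad\text{in }\mathbb{R}^n.$$ (ii) Given $l>0$, let $u_l(x)=l^{-\frac n2}u(l^{-1}x)$ for $x\in\mathbb{R}^n$. Then $u_l$ is also a solution of $(\ast)$. Furthermore, if $u\in L^2(\mathbb{R}^n)$, then $\|u_l\|_{L^2(\mathbb{R}^n)}=\|u\|_{L^2(\mathbb{R}^n)}$. (iii) Let $\tilde x\in\mathbb{R}^n$, $r>0$ and, for $x\in\mathbb{R}^n\setminus\{\tilde x\}$, let $$u^{\#_{0,r}}(x)=\Big(\frac{r}{|x-\tilde x|}\Big)^n u(x^{*,r}),\qquad x^{*,r}=\frac{r^2(x-\tilde x)}{|x-\tilde x|^2}+\tilde x.$$ Then $$\mathcal{L}_\Delta u^{\#_{0,r}}+Tu^{\#_{0,r}}=\tfrac4n u^{\#_{0,r}}\ln u^{\#_{0,r}}\quad\text{in }\mathbb{R}^n\setminus\{\tilde x\}.$$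
   Context: The logarithmic Laplacian in $\mathbb{R}^n$ is $$\mathcal{L}_\Delta u(x)=c_n\int_{\mathbb{R}^n}\frac{u(x)1_{B_1(x)}(y)-u(y)}{|x-y|^n}\,dy+\rho_n u(x),\qquad c_n=\pi^{-n/2}\Gamma(n/2),\quad \rho_n=2\ln2+\psi(\tfrac n2)-\gamma,$$ where $B_1(x)$ is the unit ball centered at $x$, $\psi=\Gamma'/\Gamma$ is the digamma function and $\gamma=-\Gamma'(1)$. The function $t\mapsto t\ln t$ on $[0,\infty)$ takes the value $0$ at $t=0$. $L^1_0(\mathbb{R}^n)$ is the space of measurable $u$ with $\int_{\mathbb{R}^n}\frac{|u(x)|}{1+|x|^n}dx<\infty$. A function $u$ is Dini continuous at $x$ if $\int_0^1\frac{\varpi_{u,x}(r)}{r}dr<\infty$, where $\varpi_{u,x}(r)=\sup_{y\in\mathbb{R}^n,\,|y-x|\le r}|u(y)-u(x)|$. $\mathcal{D}^0(\mathbb{R}^n)$ is the set of functions that are Dini continuous at every $x\in\mathbb{R}^n$. Solutions are nonnegative functions in $L^1_0(\mathbb{R}^n)\cap\mathcal{D}^0(\mathbb{R}^n)$ satisfying the equation pointwise. *)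

theory Defs
  imports "HOL-Analysis.Analysis"
begin

text \<open>
  Euclidean \<open>n\<close>-space is \<open>real ^ 'n\<close> with \<open>n = CARD('n) \<ge> 1\<close>. Measurability and integrals
  refer to Lebesgue measure, and integrals over \<open>real ^ 'n\<close> are Bochner integrals.
\<close>

definition c_const :: "nat \<Rightarrow> real" where
  "c_const n = pi powr (- (real n / 2)) * Gamma (real n / 2)"

definition rho_const :: "nat \<Rightarrow> real" where
  "rho_const n = 2 * ln 2 + Digamma (real n / 2) - euler_mascheroni"

text \<open>The library's \<open>Digamma\<close> and \<open>euler_mascheroni\<close> are \<open>\<Gamma>'/\<Gamma>\<close> and \<open>- \<Gamma>'(1)\<close>.\<close>

lemma Digamma_eq_deriv_Gamma:
  fixes x :: real
  assumes "x > 0"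
  shows "Digamma x = deriv Gamma x / Gamma x"
proof -
  have x: "x \<notin> \<int>\<^sub>\<le>\<^sub>0"
    using assms by (auto simp: nonpos_Ints_def)
  have "deriv Gamma x = Gamma x * Digamma x"
    using x by (intro DERIV_imp_deriv has_field_derivative_Gamma)
  moreover have "Gamma x \<noteq> 0"
    using Gamma_real_pos[OF assms] by linarith
  ultimately show ?thesis
    by simp
qed

lemma euler_mascheroni_eq_deriv_Gamma: "(euler_mascheroni :: real) = - deriv Gamma 1"
  using Digamma_eq_deriv_Gamma[of 1] by simp

text \<open>The integrand takes the value \<open>0\<close> at \<open>y = x\<close> (division by zero); this is a null set.\<close>

definition log_laplacian_integrand ::
    "(real ^ 'n \<Rightarrow> real) \<Rightarrow> real ^ 'n \<Rightarrow> real ^ 'n \<Rightarrow> real" where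
  "log_laplacian_integrand u x y =
     (u x * indicator (ball x 1) y - u y) / norm (x - y) ^ CARD('n)"

definition log_laplacian :: "(real ^ 'n \<Rightarrow> real) \<Rightarrow> real ^ 'n \<Rightarrow> real" where
  "log_laplacian u x =
     c_const CARD('n) * (LINT y|lebesgue. log_laplacian_integrand u x y)
     + rho_const CARD('n) * u x"

text \<open>
  The Bochner integral of a non-integrable function is \<open>0\<close>. The following predicate says that
  the integral in \<open>log_laplacian u x\<close> converges absolutely, so that the value is the intended one.
\<close>

definition log_laplacian_converges :: "(real ^ 'n \<Rightarrow> real) \<Rightarrow> real ^ 'n \<Rightarrow> bool" where
  "log_laplacian_converges u x \<longleftrightarrow> integrable lebesgue (log_laplacian_integrand u x)"

definition L10_space :: "(real ^ 'n \<Rightarrow> real) set" where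
  "L10_space = {u. u \<in> borel_measurable lebesgue \<and>
     integrable lebesgue (\<lambda>x. \<bar>u x\<bar> / (1 + norm x ^ CARD('n)))}"

text \<open>The modulus takes values in \<open>[0, \<infinity>]\<close>, since \<open>u\<close> may be unbounded near \<open>x\<close>.\<close>

definition dini_modulus :: "(real ^ 'n \<Rightarrow> real) \<Rightarrow> real ^ 'n \<Rightarrow> real \<Rightarrow> ennreal" where
  "dini_modulus u x r = (SUP y\<in>cball x r. ennreal \<bar>u y - u x\<bar>)"

definition dini_continuous_at :: "(real ^ 'n \<Rightarrow> real) \<Rightarrow> real ^ 'n \<Rightarrow> bool" where
  "dini_continuous_at u x \<longleftrightarrow>
     (\<integral>\<^sup>+r\<in>{0<..1}. (dini_modulus u x r / ennreal r) \<partial>lebesgue) < \<infinity>"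

definition dini_space :: "(real ^ 'n \<Rightarrow> real) set" where
  "dini_space = {u. \<forall>x. dini_continuous_at u x}"

text \<open>Since \<open>ln 0\<close> is multiplied by \<open>0\<close>, the convention \<open>0 ln 0 = 0\<close> holds.\<close>

definition satisfies_log_eq_at :: "real \<Rightarrow> (real ^ 'n \<Rightarrow> real) \<Rightarrow> real ^ 'n \<Rightarrow> bool" where
  "satisfies_log_eq_at T u x \<longleftrightarrow>
     log_laplacian u x + T * u x = 4 / real CARD('n) * (u x * ln (u x))"

definition log_eq_solution :: "real \<Rightarrow> (real ^ 'n \<Rightarrow> real) \<Rightarrow> bool" where
  "log_eq_solution T u \<longleftrightarrow>
     u \<in> dini_space \<and> u \<in> L10_space \<and> (\<forall>x. 0 \<le> u x) \<and> (\<forall>x. satisfies_log_eq_at T u x)"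

definition L2_space :: "(real ^ 'n \<Rightarrow> real) set" where
  "L2_space = {u. u \<in> borel_measurable lebesgue \<and> integrable lebesgue (\<lambda>x. \<bar>u x\<bar>\<^sup>2)}"

definition L2_norm :: "(real ^ 'n \<Rightarrow> real) \<Rightarrow> real" where
  "L2_norm u = sqrt (LINT x|lebesgue. \<bar>u x\<bar>\<^sup>2)"

definition sphere_inversion :: "real ^ 'n \<Rightarrow> real \<Rightarrow> real ^ 'n \<Rightarrow> real ^ 'n" where
  "sphere_inversion c r x = (r\<^sup>2 / (norm (x - c))\<^sup>2) *\<^sub>R (x - c) + c"

text \<open>
  Only the values at \<open>x \<noteq> c\<close> are meaningful. The value at \<open>c\<close> (which is \<open>0\<close>, by division by zero)
  does not affect \<open>log_laplacian\<close> at other points.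
\<close>

definition kelvin_transform ::
    "real ^ 'n \<Rightarrow> real \<Rightarrow> (real ^ 'n \<Rightarrow> real) \<Rightarrow> real ^ 'n \<Rightarrow> real" where
  "kelvin_transform c r u x = (r / norm (x - c)) ^ CARD('n) * u (sphere_inversion c r x)"

end

theory Submission
  imports Defs
begin

text \<open>
  Everything follows from how the logarithmic Laplacian \<open>L\<close> behaves under changes of variables. If the
  defining integral of \<open>L u\<close> at \<open>x\<close> converges absolutely, cutting out a small ball around \<open>x\<close> gives

    \<open>L u x = lim\<^bsub>\<epsilon> \<rightarrow> 0\<^esub> (2 ln (1 / \<epsilon>) u x - c\<^sub>n \<integral>\<^bsub>\<bar>x - y\<bar> \<ge> \<epsilon>\<^esub> u y / \<bar>x - y\<bar> ^ n dy) + \<rho>\<^sub>n u x\<close>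

  (\<open>log_laplacian_as_limit\<close>), because the kernel has mass \<open>sphere_area n * ln (1 / \<epsilon>)\<close> on the annulus
  with radii \<open>\<epsilon>\<close> and \<open>1\<close>, and \<open>c_const n * sphere_area n = 2\<close>. A change of variables that preserves the kernel and scales
  lengths near \<open>x\<close> by a factor \<open>s\<close> replaces \<open>\<epsilon>\<close> by \<open>s \<epsilon>\<close> and therefore adds \<open>2 ln s\<close> times the value of the function.

  For affine maps this gives \<open>L (k u(s x + b)) = k (L u + 2 ln s u)(s x + b)\<close>. The term \<open>2 ln s\<close> and the term
  \<open>4 / n * ln k\<close> produced by the nonlinearity combine to the shift of \<open>T\<close> in \<open>log_eq_solution_affine\<close>; they
  cancel when \<open>k = s powr (n / 2)\<close>. Convergence comes from Dini continuity near \<open>x\<close> and from the weighted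
  integrability of \<open>u\<close> at infinity.

  For the Kelvin transform, \<open>log_polar_coordinates\<close> shows that inversion in a sphere about \<open>c\<close> preserves
  \<open>dy / \<bar>y - c\<bar> ^ n\<close>: it reflects the variable \<open>ln \<bar>y - c\<bar>\<close> and fixes directions. Together with the formula
  for distances between inverted points, the Kelvin weight makes the kernel covariant
  (\<open>nn_integral_kelvin_kernel\<close>). The inversion does not map balls around \<open>x\<close> to balls around \<open>x*\<close>, but as \<open>u\<close> is
  nonnegative the tails can be squeezed between tails over complements of balls of asymptotically equal
  radii. The local scale is \<open>(r / \<bar>x - c\<bar>)\<^sup>2\<close>, so that \<open>L\<close> gains \<open>4 ln (r / \<bar>x - c\<bar>)\<close> (\<open>log_laplacian_kelvin\<close>),
  which is \<open>4 / n\<close> times the logarithm of the Kelvin weight and thus matches the nonlinearity.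
\<close>

section \<open>Polar coordinates for the scale-invariant measure\<close>

text \<open>
  The surface measure of the unit sphere, obtained from the cone measure: a set of directions is
  measured by \<open>n\<close> times the volume of the cone over it inside the unit ball.
\<close>

definition surface_measure :: "'a::euclidean_space measure" where
  "surface_measure = distr (density lborel (\<lambda>x. ennreal (real DIM('a)) * indicator (cball 0 1) x)) borel sgn"

lemma borel_measurable_sgn_vec [measurable]: "sgn \<in> borel_measurable (borel :: 'a::euclidean_space measure)"
  unfolding sgn_div_norm[abs_def] by measurable

lemma sets_surface_measure [simp, measurable_cong]: "sets surface_measure = sets borel"
  by (simp add: surface_measure_def)

lemma space_surface_measure [simp]: "space surface_measure = UNIV"
  by (simp add: surface_measure_def)

lemma emeasure_surface_measure:
  assumes [measurable]: "B \<in> sets borel"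
  shows "emeasure surface_measure B =
    ennreal (real DIM('a)) * emeasure lborel (cball 0 1 \<inter> sgn -` B :: 'a::euclidean_space set)"
proof -
  have [measurable]: "sgn -` B \<in> sets (borel :: 'a measure)"
    using measurable_sets_borel[OF borel_measurable_sgn_vec assms] by simp
  have [measurable]: "cball 0 1 \<in> sets (borel :: 'a measure)" by simp
  have "emeasure (density lborel (\<lambda>x::'a. ennreal (real DIM('a)) * indicator (cball 0 1) x)) (sgn -` B) =
     (\<integral>\<^sup>+x. ennreal (real DIM('a)) * indicator (cball 0 1) x * indicator (sgn -` B) x \<partial>(lborel::'a measure))"
    by (rule emeasure_density) simp_all
  also have "\<dots> = (\<integral>\<^sup>+x. ennreal (real DIM('a)) * indicator (cball 0 1 \<inter> sgn -` B) x \<partial>(lborel::'a measure))"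
    by (intro nn_integral_cong) (simp add: indicator_inter_arith mult.assoc)
  also have "\<dots> = ennreal (real DIM('a)) * emeasure lborel (cball 0 1 \<inter> sgn -` B :: 'a set)"
    by (rule nn_integral_cmult_indicator) simp
  finally show ?thesis
    unfolding surface_measure_def by (simp add: emeasure_distr)
qed

lemma finite_surface_measure: "finite_measure (surface_measure :: 'a::euclidean_space measure)"
  by (rule finite_measureI)
    (simp add: emeasure_surface_measure emeasure_cball ennreal_mult_eq_top_iff)

lemma emeasure_surface_measure_UNIV:
  "emeasure surface_measure (UNIV :: 'a::euclidean_space set) =
    ennreal (real DIM('a) * unit_ball_vol (real DIM('a)))"
  by (simp add: emeasure_surface_measure emeasure_cball ennreal_mult)

lemma emeasure_cone_cball:
  assumes [measurable]: "B \<in> sets borel" and t: "t > 0"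
  shows "emeasure lborel (cball 0 t \<inter> sgn -` B :: 'a::euclidean_space set) =
     ennreal (t ^ DIM('a)) * emeasure lborel (cball 0 1 \<inter> sgn -` B :: 'a set)"
proof -
  have [measurable]: "sgn -` B \<in> sets (borel :: 'a measure)"
    using measurable_sets_borel[OF borel_measurable_sgn_vec assms(1)] by simp
  have eq: "(\<lambda>x. t *\<^sub>R x) -` (cball 0 t \<inter> sgn -` B) = (cball 0 1 \<inter> sgn -` B :: 'a set)"
    using t by (auto simp: sgn_scaleR dist_norm)
  have "emeasure lborel (cball 0 t \<inter> sgn -` B :: 'a set) =
      emeasure (density (distr lborel borel (\<lambda>x. 0 + t *\<^sub>R x)) (\<lambda>_. \<bar>t\<bar>^DIM('a))) (cball 0 t \<inter> sgn -` B :: 'a set)"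
    using lborel_affine[of t "0::'a"] t by simp
  also have "\<dots> = ennreal (t ^ DIM('a)) * emeasure (distr lborel borel (\<lambda>x. 0 + t *\<^sub>R x)) (cball 0 t \<inter> sgn -` B :: 'a set)"
    using t by (simp add: emeasure_density nn_integral_cmult del: nn_integral_cmult_indicator)
      (simp add: nn_integral_cmult_indicator)
  also have "\<dots> = ennreal (t ^ DIM('a)) * emeasure lborel (cball 0 1 \<inter> sgn -` B :: 'a set)"
    using t by (simp add: emeasure_distr eq del: vimage_Int)
  finally show ?thesis .
qed

lemma nn_integral_power_Icc:
  assumes "D > 0" "0 \<le> t"
  shows "(\<integral>\<^sup>+s. ennreal (real D * s ^ (D - 1)) * indicator {0..t} s \<partial>lborel) = ennreal (t ^ D)"
proof -
  have "(\<integral>\<^sup>+s. ennreal (real D * s ^ (D - 1)) * indicator {0..t} s \<partial>lborel) = ennreal (t ^ D - 0 ^ D)"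
    using assms by (intro nn_integral_FTC_Icc) (auto intro!: derivative_eq_intros)
  then show ?thesis using assms by simp
qed

text \<open>
  By scaling, the part of a cone in the ball of radius \<open>t\<close> has volume \<open>t ^ n\<close> times its volume in the unit
  ball, and \<open>t ^ n / n\<close> is a primitive of \<open>t ^ (n - 1)\<close>. The half-lines \<open>{..t}\<close> generate the Borel sets, so
  this determines the distribution of the radius on the cone.
\<close>

lemma cone_radial_law:
  assumes [measurable]: "B \<in> sets borel"
  shows "distr (density lborel (indicator (sgn -` B :: 'a::euclidean_space set))) borel norm =
    density lborel (\<lambda>t. emeasure (surface_measure :: 'a measure) B * ennreal (t ^ (DIM('a) - 1)) * indicator {0..} t)"
    (is "?M = ?N")
proof (rule measure_eqI_generator_eq)
  let ?E = "range (\<lambda>a::real. {..a})"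
  have [measurable]: "sgn -` B \<in> sets (borel :: 'a measure)"
    using measurable_sets_borel[OF borel_measurable_sgn_vec assms(1)] by simp
  let ?v = "emeasure lborel (cball 0 1 \<inter> sgn -` B :: 'a set)"
  have M: "emeasure ?M {..t} = emeasure lborel (cball 0 t \<inter> sgn -` B :: 'a set)" for t
  proof -
    have *: "norm -` {..t} = (cball 0 t :: 'a set)" by auto
    show ?thesis
      by (simp add: emeasure_distr emeasure_density * Int_commute flip: indicator_inter_arith)
  qed
  have N: "emeasure ?N {..t} = ?v * (\<integral>\<^sup>+s. ennreal (real DIM('a) * s ^ (DIM('a) - 1)) * indicator {0..t} s \<partial>lborel)" for t
    by (subst emeasure_density, simp, simp, subst nn_integral_cmult[symmetric], simp)
      (auto intro!: nn_integral_cong simp: emeasure_surface_measure ennreal_mult mult_ac split: split_indicator)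
  show eq: "emeasure ?M X = emeasure ?N X" if X: "X \<in> ?E" for X
  proof -
    obtain t where X: "X = {..t}" using X by auto
    show ?thesis
    proof (cases "t > 0")
      case True
      then show ?thesis unfolding X M N
        by (subst nn_integral_power_Icc) (simp_all add: emeasure_cone_cball[OF assms True] mult.commute)
    next
      case False
      have "emeasure lborel (cball 0 t \<inter> sgn -` B :: 'a set) \<le> emeasure lborel {0::'a}"
        using False by (intro emeasure_mono) (auto simp: norm_le_zero_iff[symmetric] simp del: norm_le_zero_iff)
      moreover have "(\<integral>\<^sup>+s. ennreal (real DIM('a) * s ^ (DIM('a) - 1)) * indicator {0..t} s \<partial>lborel) \<le> (\<integral>\<^sup>+s. ennreal (real DIM('a) * s ^ (DIM('a) - 1)) * indicator {0..0} s \<partial>lborel)"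
        using False by (intro nn_integral_mono) (auto split: split_indicator)
      ultimately show ?thesis unfolding X M N using nn_integral_power_Icc[of "DIM('a)" 0]
        by simp
    qed
  qed
  show "Int_stable ?E" by (auto simp: Int_stable_def)
  show "sets ?M = sigma_sets UNIV ?E" "sets ?N = sigma_sets UNIV ?E"
    by (simp_all add: borel_eq_atMost)
  show "range (\<lambda>i::nat. {..real i}) \<subseteq> ?E" by auto
  show "(\<Union>i::nat. {..real i}) = UNIV" using real_arch_simple by auto
  show "emeasure ?M {..real i} \<noteq> \<infinity>" for i :: nat
  proof -
    have "emeasure ?M {..real i} \<le> emeasure lborel (cball 0 (real i) :: 'a set)"
      unfolding M by (intro emeasure_mono) auto
    also have "\<dots> < \<infinity>" by (simp add: emeasure_cball)
    finally show ?thesis by simp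
  qed
qed auto

lemma nn_integral_radial_cone:
  assumes [measurable]: "g \<in> borel_measurable borel" "B \<in> sets borel"
  shows "(\<integral>\<^sup>+x. g (norm x) * indicator B (sgn x) \<partial>(lborel::'a::euclidean_space measure)) =
    emeasure (surface_measure :: 'a measure) B * (\<integral>\<^sup>+t. g t * ennreal (t ^ (DIM('a) - 1)) * indicator {0..} t \<partial>lborel)"
proof -
  have [measurable]: "sgn -` B \<in> sets (borel :: 'a measure)"
    using measurable_sets_borel[OF borel_measurable_sgn_vec assms(2)] by simp
  have "(\<integral>\<^sup>+x. g (norm x) * indicator B (sgn x) \<partial>(lborel::'a measure)) =
     (\<integral>\<^sup>+t. g t \<partial>distr (density lborel (indicator (sgn -` B :: 'a set))) borel norm)"
    by (simp add: nn_integral_distr nn_integral_density indicator_vimage mult.commute)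
  also have "\<dots> = (\<integral>\<^sup>+t. emeasure (surface_measure :: 'a measure) B * (g t * ennreal (t ^ (DIM('a) - 1)) * indicator {0..} t) \<partial>lborel)"
    unfolding cone_radial_law[OF assms(2)]
    by (simp add: nn_integral_density mult_ac)
  finally show ?thesis by (simp add: nn_integral_cmult)
qed

lemma nn_integral_radial:
  assumes [measurable]: "g \<in> borel_measurable borel"
  shows "(\<integral>\<^sup>+x. g (norm x) \<partial>(lborel::'a::euclidean_space measure)) =
    ennreal (real DIM('a) * unit_ball_vol (real DIM('a))) * (\<integral>\<^sup>+t. g t * ennreal (t ^ (DIM('a) - 1)) * indicator {0..} t \<partial>lborel)"
  using nn_integral_radial_cone[where B="UNIV :: 'a set", OF assms] by (simp add: emeasure_surface_measure_UNIV)

lemma power_kernel_mult: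
  fixes t :: real
  assumes "t > 0" "D > 0"
  shows "1 / t ^ D * t ^ (D - 1) = 1 / t"
proof -
  have "t ^ D = t * t ^ (D - 1)"
    using assms by (metis Suc_diff_1 power_Suc)
  then show ?thesis using assms by simp
qed

lemma nn_integral_dlog_Icc:
  assumes "0 < s" "s \<le> t"
  shows "(\<integral>\<^sup>+r. ennreal (1 / r) * indicator {s..t} r \<partial>lborel) = ennreal (ln (t / s))"
proof -
  have "(\<integral>\<^sup>+r. ennreal (1 / r) * indicator {s..t} r \<partial>lborel) = ennreal (ln t - ln s)"
    using assms by (intro nn_integral_FTC_Icc) (auto intro!: derivative_eq_intros)
  then show ?thesis using assms by (simp add: ln_div)
qed

lemma distr_dlog: "lborel = distr (density lborel (\<lambda>t. ennreal (1 / t) * indicator {0<..} t)) borel (ln :: real \<Rightarrow> real)"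
proof (rule lborel_eqI)
  fix l u :: real assume "\<And>b. b \<in> Basis \<Longrightarrow> l \<bullet> b \<le> u \<bullet> b"
  then have lu: "l \<le> u" by simp
  have "emeasure (distr (density lborel (\<lambda>t. ennreal (1 / t) * indicator {0<..} t)) borel ln) (box l u) =
      (\<integral>\<^sup>+t. ennreal (1 / t) * indicator {0<..} t * indicator (ln -` {l<..<u}) t \<partial>lborel)"
    by (simp add: emeasure_distr emeasure_density measurable_sets_borel[OF borel_measurable_ln[OF measurable_ident], simplified])
  also have "\<dots> = (\<integral>\<^sup>+t. ennreal (1 / t) * indicator {exp l..exp u} t \<partial>lborel)"
  proof (rule nn_integral_cong_AE)
    have "AE t in lborel. t \<noteq> exp l" "AE t in lborel. t \<noteq> exp u"
      by (rule AE_lborel_singleton)+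
    then show "AE t in lborel. ennreal (1 / t) * indicator {0<..} t * indicator (ln -` {l<..<u}) t = ennreal (1 / t) * indicator {exp l..exp u} t"
    proof eventually_elim
      case (elim t)
      have "0 < t \<and> l < ln t \<and> ln t < u \<longleftrightarrow> exp l \<le> t \<and> t \<le> exp u"
        using elim by (smt (verit) exp_gt_zero exp_le_cancel_iff exp_ln ln_exp ln_ge_iff)
      then show ?case by (auto split: split_indicator)
    qed
  qed
  also have "\<dots> = ennreal (u - l)"
    using lu by (subst nn_integral_dlog_Icc) (simp_all add: ln_div)
  finally show "emeasure (distr (density lborel (\<lambda>t. ennreal (1 / t) * indicator {0<..} t)) borel ln) (box l u) = ennreal (\<Prod>b\<in>Basis. (u - l) \<bullet> b)"
    by simp
qed simp

text \<open>
  In logarithmic polar coordinates the scale-invariant measure \<open>dx / \<bar>x\<bar> ^ n\<close> becomes a product of a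
  translation-invariant measure in \<open>ln \<bar>x\<bar>\<close> and the surface measure. Since the kernel of the logarithmic
  Laplacian is exactly \<open>1 / \<bar>x\<bar> ^ n\<close>, dilations and inversions turn into translations and reflections of
  the line.
\<close>

lemma log_polar_coordinates:
  "(lborel \<Otimes>\<^sub>M surface_measure) =
    distr (density lborel (\<lambda>x::'a::euclidean_space. ennreal (1 / norm x ^ DIM('a)))) (borel \<Otimes>\<^sub>M borel) (\<lambda>x. (ln (norm x), sgn x))"
proof (rule pair_measure_eqI)
  show "sigma_finite_measure (surface_measure :: 'a measure)"
    by (intro finite_measure.axioms finite_surface_measure)
next
  fix A :: "real set" and B :: "'a set" assume "A \<in> sets lborel" "B \<in> sets surface_measure"
  then have [measurable]: "A \<in> sets borel" "B \<in> sets borel" by simp_all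
  have "emeasure (distr (density lborel (\<lambda>x::'a. ennreal (1 / norm x ^ DIM('a)))) (borel \<Otimes>\<^sub>M borel) (\<lambda>x. (ln (norm x), sgn x))) (A \<times> B)
    = (\<integral>\<^sup>+x. indicator (A \<times> B) (ln (norm x), sgn x) * ennreal (1 / norm x ^ DIM('a)) \<partial>(lborel::'a measure))"
    by (subst nn_integral_indicator[symmetric], simp, subst nn_integral_distr, simp, simp, subst nn_integral_density)
      (auto simp: mult.commute)
  also have "\<dots> = (\<integral>\<^sup>+x. (indicator A (ln (norm x)) * ennreal (1 / norm x ^ DIM('a))) * indicator B (sgn x) \<partial>(lborel::'a measure))"
    by (intro nn_integral_cong) (auto split: split_indicator)
  also have "\<dots> = emeasure (surface_measure :: 'a measure) B *
      (\<integral>\<^sup>+t. (indicator A (ln t) * ennreal (1 / t ^ DIM('a))) * ennreal (t ^ (DIM('a) - 1)) * indicator {0..} t \<partial>lborel)"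
    by (rule nn_integral_radial_cone) measurable
  also have "(\<integral>\<^sup>+t. (indicator A (ln t) * ennreal (1 / t ^ DIM('a))) * ennreal (t ^ (DIM('a) - 1)) * indicator {0..} t \<partial>lborel)
    = (\<integral>\<^sup>+t. ennreal (1 / t) * indicator {0<..} t * indicator A (ln t) \<partial>lborel)"
  proof (intro nn_integral_cong)
    fix t :: real
    have "1 / t ^ DIM('a) * t ^ (DIM('a) - 1) = 1 / t" if "t > 0"
      using that by (rule power_kernel_mult) simp
    then show "indicator A (ln t) * ennreal (1 / t ^ DIM('a)) * ennreal (t ^ (DIM('a) - 1)) * indicator {0..} t =
       ennreal (1 / t) * indicator {0<..} t * indicator A (ln t)"
      by (cases "t > 0"; cases "t = 0") (auto split: split_indicator simp flip: ennreal_mult)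
  qed
  also have "\<dots> = (\<integral>\<^sup>+s. indicator A s \<partial>distr (density lborel (\<lambda>t. ennreal (1 / t) * indicator {0<..} t)) borel (ln :: real \<Rightarrow> real))"
    by (simp add: nn_integral_distr nn_integral_density del: nn_integral_indicator)
  also have "\<dots> = emeasure lborel A"
    unfolding distr_dlog[symmetric] by simp
  finally show "emeasure lborel A * emeasure surface_measure B = emeasure (distr (density lborel (\<lambda>x::'a. ennreal (1 / norm x ^ DIM('a)))) (borel \<Otimes>\<^sub>M borel) (\<lambda>x. (ln (norm x), sgn x))) (A \<times> B)"
    by (simp add: mult.commute)
qed (auto intro: sigma_finite_lborel)

lemma nn_integral_log_polar:
  assumes [measurable]: "f \<in> borel_measurable borel"
  shows "(\<integral>\<^sup>+x. f x * ennreal (1 / norm x ^ DIM('a)) \<partial>(lborel::'a::euclidean_space measure)) =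
    (\<integral>\<^sup>+\<theta>. (\<integral>\<^sup>+s. f (exp s *\<^sub>R \<theta>) \<partial>lborel) \<partial>surface_measure)"
proof -
  interpret pair_sigma_finite "lborel::real measure" "surface_measure :: 'a measure"
    unfolding pair_sigma_finite_def
    by (auto intro: sigma_finite_lborel finite_measure.axioms finite_surface_measure)
  have "(\<integral>\<^sup>+\<theta>. (\<integral>\<^sup>+s. f (exp s *\<^sub>R \<theta>) \<partial>lborel) \<partial>surface_measure) =
      (\<integral>\<^sup>+p. f (exp (fst p) *\<^sub>R snd p) \<partial>(lborel \<Otimes>\<^sub>M surface_measure))"
    by (subst nn_integral_snd[symmetric]) (auto simp: case_prod_beta')
  also have "\<dots> = (\<integral>\<^sup>+x. f (exp (ln (norm x)) *\<^sub>R sgn x) * ennreal (1 / norm x ^ DIM('a)) \<partial>(lborel::'a measure))"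
    unfolding log_polar_coordinates
    by (subst nn_integral_distr, simp, simp, subst nn_integral_density) (auto simp: mult.commute)
  also have "\<dots> = (\<integral>\<^sup>+x. f x * ennreal (1 / norm x ^ DIM('a)) \<partial>(lborel::'a measure))"
  proof (intro nn_integral_cong)
    fix x :: 'a
    show "f (exp (ln (norm x)) *\<^sub>R sgn x) * ennreal (1 / norm x ^ DIM('a)) = f x * ennreal (1 / norm x ^ DIM('a))"
      by (cases "x = 0") (auto simp: sgn_div_norm)
  qed
  finally show ?thesis by simp
qed

section \<open>Inversion in a sphere\<close>

lemma AE_surface_measure_norm_1: "AE \<theta> in surface_measure. norm (\<theta> :: 'a::euclidean_space) = 1"
proof -
  have *: "cball 0 1 \<inter> {x. norm (sgn x) \<noteq> 1} = {0::'a}"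
    by (auto simp: norm_sgn)
  have [measurable]: "{\<theta>::'a. norm \<theta> \<noteq> 1} \<in> sets borel" by measurable
  have "{\<theta> \<in> space surface_measure. norm (\<theta>::'a) \<noteq> 1} \<in> null_sets surface_measure"
    by (intro null_setsI) (auto simp: emeasure_surface_measure *)
  then show ?thesis by (subst AE_iff_null) auto
qed

lemma nn_integral_lborel_affine:
  fixes f :: "'a::euclidean_space \<Rightarrow> ennreal"
  assumes [measurable]: "f \<in> borel_measurable borel" and s: "s \<noteq> 0"
  shows "(\<integral>\<^sup>+x. f x \<partial>lborel) = ennreal (\<bar>s\<bar> ^ DIM('a)) * (\<integral>\<^sup>+x. f (s *\<^sub>R x + b) \<partial>lborel)"
proof -
  have "(\<integral>\<^sup>+x. f x \<partial>lborel) = (\<integral>\<^sup>+x. f x \<partial>density (distr lborel borel (\<lambda>x. b + s *\<^sub>R x)) (\<lambda>_. \<bar>s\<bar> ^ DIM('a)))"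
    using lborel_affine[OF s, of b] by simp
  then show ?thesis
    by (simp add: nn_integral_density nn_integral_distr nn_integral_cmult add.commute)
qed

text \<open>
  The inversion in the sphere of radius \<open>r\<close> about the origin fixes the direction of \<open>x\<close> and maps \<open>ln \<bar>x\<bar>\<close> to
  \<open>2 ln r - ln \<bar>x\<bar>\<close>, and reflections of the line preserve Lebesgue measure. This replaces the
  computation of the Jacobian determinant of the inversion.
\<close>

lemma nn_integral_inversion_origin:
  fixes f :: "'a::euclidean_space \<Rightarrow> ennreal"
  assumes [measurable]: "f \<in> borel_measurable borel" and r: "r > 0"
  shows "(\<integral>\<^sup>+x. f ((r\<^sup>2 / (norm x)\<^sup>2) *\<^sub>R x) * ennreal (1 / norm x ^ DIM('a)) \<partial>lborel) =
    (\<integral>\<^sup>+x. f x * ennreal (1 / norm x ^ DIM('a)) \<partial>lborel)"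
proof -
  have "(\<integral>\<^sup>+x. f ((r\<^sup>2 / (norm x)\<^sup>2) *\<^sub>R x) * ennreal (1 / norm x ^ DIM('a)) \<partial>lborel) =
    (\<integral>\<^sup>+\<theta>. (\<integral>\<^sup>+s. f ((r\<^sup>2 / (norm (exp s *\<^sub>R \<theta>))\<^sup>2) *\<^sub>R (exp s *\<^sub>R \<theta>)) \<partial>lborel) \<partial>(surface_measure :: 'a measure))"
    by (rule nn_integral_log_polar) measurable
  also have "\<dots> = (\<integral>\<^sup>+\<theta>. (\<integral>\<^sup>+s. f (exp s *\<^sub>R \<theta>) \<partial>lborel) \<partial>(surface_measure :: 'a measure))"
  proof (rule nn_integral_cong_AE, use AE_surface_measure_norm_1 in eventually_elim)
    case (elim \<theta>)
    have "(r\<^sup>2 / (norm (exp s *\<^sub>R \<theta>))\<^sup>2) *\<^sub>R (exp s *\<^sub>R \<theta>) = exp (2 * ln r + (-1) * s) *\<^sub>R \<theta>" for s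
    proof -
      have "exp (2 * ln r + (-1) * s) = r\<^sup>2 / exp s"
        using r by (simp add: exp_add exp_diff mult_exp_exp[symmetric] power2_eq_square exp_double)
      then show ?thesis using elim by (simp add: power2_eq_square)
    qed
    note eq = this
    show ?case
      unfolding eq using nn_integral_real_affine[of "\<lambda>s. f (exp s *\<^sub>R \<theta>)" "-1" "2 * ln r"] by simp
  qed
  also have "\<dots> = (\<integral>\<^sup>+x. f x * ennreal (1 / norm x ^ DIM('a)) \<partial>lborel)"
    by (rule nn_integral_log_polar[symmetric]) measurable
  finally show ?thesis .
qed

lemma borel_measurable_sphere_inversion [measurable]: "sphere_inversion c r \<in> borel_measurable borel"
  unfolding sphere_inversion_def[abs_def] by measurable

lemma nn_integral_sphere_inversion:
  fixes f :: "real ^ 'n \<Rightarrow> ennreal"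
  assumes [measurable]: "f \<in> borel_measurable borel" and r: "r > 0"
  shows "(\<integral>\<^sup>+x. f (sphere_inversion c r x) * ennreal (1 / norm (x - c) ^ CARD('n)) \<partial>lborel) =
    (\<integral>\<^sup>+x. f x * ennreal (1 / norm (x - c) ^ CARD('n)) \<partial>lborel)"
proof -
  have "(\<integral>\<^sup>+x. f (sphere_inversion c r x) * ennreal (1 / norm (x - c) ^ CARD('n)) \<partial>lborel)
     = (\<integral>\<^sup>+x. f ((r\<^sup>2 / (norm x)\<^sup>2) *\<^sub>R x + c) * ennreal (1 / norm x ^ DIM(real ^ 'n)) \<partial>lborel)"
    by (subst nn_integral_lborel_affine[where s=1 and b=c]) (simp_all add: sphere_inversion_def)
  also have "\<dots> = (\<integral>\<^sup>+x. f (x + c) * ennreal (1 / norm x ^ DIM(real ^ 'n)) \<partial>lborel)"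
    by (rule nn_integral_inversion_origin) (use r in measurable)
  also have "\<dots> = (\<integral>\<^sup>+x. f x * ennreal (1 / norm (x - c) ^ CARD('n)) \<partial>lborel)"
    by (subst (2) nn_integral_lborel_affine[where s=1 and b=c]) simp_all
  finally show ?thesis .
qed

lemma norm_sphere_inversion_center:
  "norm (sphere_inversion c r x - c) = r\<^sup>2 / norm (x - c)"
  by (cases "x = c") (simp_all add: sphere_inversion_def power2_eq_square)

lemma sphere_inversion_ne_center: "r > 0 \<Longrightarrow> x \<noteq> c \<Longrightarrow> sphere_inversion c r x \<noteq> c"
  using norm_sphere_inversion_center[of c r x] by auto

lemma sphere_inversion_involution:
  assumes "x \<noteq> c" "r > 0" shows "sphere_inversion c r (sphere_inversion c r x) = x"
proof -
  have "sphere_inversion c r (sphere_inversion c r x) =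
     (r\<^sup>2 / (r\<^sup>2 / norm (x - c))\<^sup>2) *\<^sub>R (sphere_inversion c r x - c) + c"
    by (simp add: sphere_inversion_def[of c r "sphere_inversion c r x"] norm_sphere_inversion_center)
  also have "\<dots> = x"
    using assms by (simp add: sphere_inversion_def power2_eq_square)
  finally show ?thesis .
qed

lemma norm_sphere_inversion_diff:
  assumes "x \<noteq> c" "y \<noteq> c" "r > 0"
  shows "norm (sphere_inversion c r x - sphere_inversion c r y) =
    r\<^sup>2 * norm (x - y) / (norm (x - c) * norm (y - c))"
proof -
  define a b where "a = x - c" and "b = y - c"
  have nz: "norm a \<noteq> 0" "norm b \<noteq> 0" using assms by (auto simp: a_def b_def)
  have d: "sphere_inversion c r x - sphere_inversion c r y = r\<^sup>2 *\<^sub>R ((1 / (norm a)\<^sup>2) *\<^sub>R a - (1 / (norm b)\<^sup>2) *\<^sub>R b)"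
    by (simp add: sphere_inversion_def a_def b_def scaleR_diff_right)
  have expand: "(norm (\<alpha> *\<^sub>R a - \<beta> *\<^sub>R b))\<^sup>2 = \<alpha>\<^sup>2 * (norm a)\<^sup>2 - 2 * \<alpha> * \<beta> * (a \<bullet> b) + \<beta>\<^sup>2 * (norm b)\<^sup>2" for \<alpha> \<beta>
    unfolding power2_norm_eq_inner
    by (simp add: inner_diff_left inner_diff_right inner_commute[of b a] power2_eq_square algebra_simps)
  have "(norm ((1 / (norm a)\<^sup>2) *\<^sub>R a - (1 / (norm b)\<^sup>2) *\<^sub>R b))\<^sup>2 =
     (1 / (norm a)\<^sup>2)\<^sup>2 * (norm a)\<^sup>2 - 2 * (1 / (norm a)\<^sup>2) * (1 / (norm b)\<^sup>2) * (a \<bullet> b) + (1 / (norm b)\<^sup>2)\<^sup>2 * (norm b)\<^sup>2"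
    by (rule expand)
  also have "\<dots> = ((norm a)\<^sup>2 - 2 * (a \<bullet> b) + (norm b)\<^sup>2) / ((norm a)\<^sup>2 * (norm b)\<^sup>2)"
    using nz by (simp add: field_simps power2_eq_square)
  also have "\<dots> = (norm (a - b))\<^sup>2 / ((norm a)\<^sup>2 * (norm b)\<^sup>2)"
    using expand[of 1 1] by simp
  also have "\<dots> = (norm (a - b) / (norm a * norm b))\<^sup>2"
    by (simp add: power_divide power_mult_distrib)
  finally have "norm ((1 / (norm a)\<^sup>2) *\<^sub>R a - (1 / (norm b)\<^sup>2) *\<^sub>R b) = norm (a - b) / (norm a * norm b)"
    by (rule power2_eq_imp_eq) simp_all
  then show ?thesis unfolding d by (simp add: a_def b_def)
qed

lemma ennreal_mult_regroup:
  assumes "0 \<le> a" "0 \<le> c" "a * b = c * d"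
  shows "\<phi> * ennreal a * ennreal b = ennreal c * \<phi> * ennreal d"
proof -
  have "ennreal a * ennreal b = ennreal c * ennreal d"
    using assms by (simp flip: ennreal_mult')
  then show ?thesis
    by (metis mult.assoc mult.commute)
qed

text \<open>
  The Kelvin weight \<open>(r / \<bar>y - c\<bar>) ^ n\<close> is the one for which the kernel of the logarithmic Laplacian is
  covariant. Write \<open>y*\<close> for the inversion of \<open>y\<close> and apply the invariance of \<open>dy / \<bar>y - c\<bar> ^ n\<close> to the
  integrand rewritten by means of \<open>\<bar>x* - y*\<bar> = r\<^sup>2 \<bar>x - y\<bar> / (\<bar>x - c\<bar> \<bar>y - c\<bar>)\<close>.
\<close>

lemma nn_integral_kelvin_kernel:
  fixes c x :: "real ^ 'n" and \<phi> :: "real ^ 'n \<Rightarrow> ennreal"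
  assumes [measurable]: "\<phi> \<in> borel_measurable borel" and r: "r > 0" and x: "x \<noteq> c"
  shows "(\<integral>\<^sup>+y. ennreal ((r / norm (y - c)) ^ CARD('n)) * \<phi> (sphere_inversion c r y) * ennreal (1 / norm (x - y) ^ CARD('n)) \<partial>lborel)
    = ennreal ((r / norm (x - c)) ^ CARD('n)) * (\<integral>\<^sup>+z. \<phi> z * ennreal (1 / norm (sphere_inversion c r x - z) ^ CARD('n)) \<partial>lborel)"
    (is "_ = ennreal ?\<kappa> * _")
proof -
  let ?inv = "sphere_inversion c r"
  let ?f = "\<lambda>z. \<phi> z * ennreal (?\<kappa> * (norm (z - c) / norm (?inv x - z)) ^ CARD('n))"
  have ne: "AE y in lborel. y \<noteq> c" by (rule AE_lborel_singleton)
  have "(\<integral>\<^sup>+y. ennreal ((r / norm (y - c)) ^ CARD('n)) * \<phi> (?inv y) * ennreal (1 / norm (x - y) ^ CARD('n)) \<partial>lborel) =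
      (\<integral>\<^sup>+y. ?f (?inv y) * ennreal (1 / norm (y - c) ^ CARD('n)) \<partial>lborel)"
  proof (rule nn_integral_cong_AE, use ne in eventually_elim)
    case (elim y)
    have "norm (?inv y - c) / norm (?inv x - ?inv y) = norm (x - c) / norm (x - y)"
      using r x elim by (simp add: norm_sphere_inversion_diff norm_sphere_inversion_center)
    then have "?\<kappa> * (norm (?inv y - c) / norm (?inv x - ?inv y)) ^ CARD('n) * (1 / norm (y - c) ^ CARD('n))
       = (r / norm (y - c)) ^ CARD('n) * (1 / norm (x - y) ^ CARD('n))"
      using x elim by (simp add: field_simps)
    then show ?case using r by (intro ennreal_mult_regroup[symmetric]) simp_all
  qed
  also have "\<dots> = (\<integral>\<^sup>+z. ?f z * ennreal (1 / norm (z - c) ^ CARD('n)) \<partial>lborel)"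
    by (rule nn_integral_sphere_inversion) (use r in measurable)
  also have "\<dots> = (\<integral>\<^sup>+z. ennreal ?\<kappa> * (\<phi> z * ennreal (1 / norm (?inv x - z) ^ CARD('n))) \<partial>lborel)"
  proof (rule nn_integral_cong_AE, use ne in eventually_elim)
    case (elim z)
    have "?\<kappa> * (norm (z - c) / norm (?inv x - z)) ^ CARD('n) * (1 / norm (z - c) ^ CARD('n)) = ?\<kappa> * (1 / norm (?inv x - z) ^ CARD('n))"
      using elim by (simp add: power_divide)
    then show ?case using r
      by (subst ennreal_mult_regroup) (simp_all add: mult.assoc)
  qed
  also have "\<dots> = ennreal ?\<kappa> * (\<integral>\<^sup>+z. \<phi> z * ennreal (1 / norm (?inv x - z) ^ CARD('n)) \<partial>lborel)"
    by (rule nn_integral_cmult) measurable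
  finally show ?thesis .
qed

section \<open>Dini continuity and the logarithmic Laplacian as a limit of tails\<close>

definition sphere_area :: "nat \<Rightarrow> real" where
  "sphere_area n = real n * unit_ball_vol (real n)"

lemma sphere_area_nonneg [simp]: "0 \<le> sphere_area n"
  by (simp add: sphere_area_def)

lemma c_const_sphere_area:
  assumes "n > 0" shows "c_const n * sphere_area n = 2"
proof -
  have G: "Gamma (real n / 2 + 1) = real n / 2 * Gamma (real n / 2)"
    using assms by (intro Gamma_plus1) (auto simp: nonpos_Ints_def)
  have "Gamma (real n / 2) > 0" using assms by (intro Gamma_real_pos) auto
  then have g: "Gamma (real n / 2) \<noteq> 0" by simp
  have p: "pi powr - (real n / 2) * pi powr (real n / 2) = 1"
    by (simp flip: powr_add)
  have "c_const n * sphere_area n =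
      (pi powr - (real n / 2) * pi powr (real n / 2)) * (Gamma (real n / 2) * real n / (real n / 2 * Gamma (real n / 2)))"
    by (simp add: c_const_def sphere_area_def unit_ball_vol_def G)
  also have "\<dots> = 2" unfolding p using assms g by simp
  finally show ?thesis .
qed

lemma nn_integral_radial_about:
  fixes x :: "real ^ 'n"
  assumes [measurable]: "g \<in> borel_measurable borel"
  shows "(\<integral>\<^sup>+y. g (norm (x - y)) \<partial>lborel) =
    ennreal (sphere_area CARD('n)) * (\<integral>\<^sup>+t. g t * ennreal (t ^ (CARD('n) - 1)) * indicator {0..} t \<partial>lborel)"
proof -
  have "(\<integral>\<^sup>+y. g (norm (x - y)) \<partial>lborel) = (\<integral>\<^sup>+y. g (norm y) \<partial>(lborel :: (real^'n) measure))"
    by (subst nn_integral_lborel_affine[where s="-1" and b=x]) simp_all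
  then show ?thesis by (simp add: nn_integral_radial sphere_area_def)
qed

text \<open>
  The logarithm that appears in all transformation laws: it measures how the truncated kernel
  integral depends on the radius at which it is cut off.
\<close>

lemma nn_integral_annulus:
  fixes x :: "real ^ 'n"
  assumes "0 < s" "s \<le> t"
  shows "(\<integral>\<^sup>+y. ennreal (1 / norm (x - y) ^ CARD('n)) * indicator (ball x t - ball x s) y \<partial>lborel)
    = ennreal (sphere_area CARD('n) * ln (t / s))"
proof -
  have "(\<integral>\<^sup>+y. ennreal (1 / norm (x - y) ^ CARD('n)) * indicator (ball x t - ball x s) y \<partial>lborel) =
     (\<integral>\<^sup>+y. ennreal (1 / norm (x - y) ^ CARD('n)) * indicator {s..<t} (norm (x - y)) \<partial>lborel)"
    by (intro nn_integral_cong) (auto simp: dist_norm split: split_indicator)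
  also have "\<dots> = ennreal (sphere_area CARD('n)) *
      (\<integral>\<^sup>+d. ennreal (1 / d ^ CARD('n)) * indicator {s..<t} d * ennreal (d ^ (CARD('n) - 1)) * indicator {0..} d \<partial>lborel)"
    by (rule nn_integral_radial_about) measurable
  also have "(\<integral>\<^sup>+d. ennreal (1 / d ^ CARD('n)) * indicator {s..<t} d * ennreal (d ^ (CARD('n) - 1)) * indicator {0..} d \<partial>lborel)
     = (\<integral>\<^sup>+d. ennreal (1 / d) * indicator {s..t} d \<partial>lborel)"
  proof (rule nn_integral_cong_AE, use AE_lborel_singleton[of t] in eventually_elim)
    case (elim d)
    have "1 / d ^ CARD('n) * d ^ (CARD('n) - 1) = 1 / d" if "d > 0"
      using that by (rule power_kernel_mult) simp
    then show ?case using elim assms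
      by (auto split: split_indicator simp flip: ennreal_mult)
  qed
  also have "\<dots> = ennreal (ln (t / s))"
    by (rule nn_integral_dlog_Icc[OF assms])
  finally show ?thesis using assms by (simp flip: ennreal_mult)
qed

lemma dini_modulus_mono: "mono (dini_modulus u x)"
  unfolding dini_modulus_def by (intro monoI SUP_subset_mono) auto

lemma borel_measurable_mono_ennreal:
  fixes f :: "real \<Rightarrow> ennreal"
  assumes "mono f" shows "f \<in> borel_measurable borel"
proof (rule borel_measurableI_greater)
  fix y
  have "is_interval {x. y < f x}"
    unfolding is_interval_1 using assms by (auto dest!: monoD intro: less_le_trans)
  then show "{x \<in> space borel. y < f x} \<in> sets borel"
    using real_interval_borel_measurable by auto
qed

lemma borel_measurable_dini_modulus [measurable]: "dini_modulus u x \<in> borel_measurable borel"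
  by (rule borel_measurable_mono_ennreal[OF dini_modulus_mono])

lemma dini_modulus_upper: "norm (x - y) \<le> r \<Longrightarrow> ennreal \<bar>u x - u y\<bar> \<le> dini_modulus u x r"
  unfolding dini_modulus_def
  by (subst abs_minus_commute) (intro SUP_upper, simp add: dist_norm)

lemma dini_continuous_at_iff:
  "dini_continuous_at u x \<longleftrightarrow> (\<integral>\<^sup>+r\<in>{0<..1}. (dini_modulus u x r / ennreal r) \<partial>lborel) < \<infinity>"
  unfolding dini_continuous_at_def nn_integral_completion ..

text \<open>
  Otherwise the modulus would be at least \<open>e\<close> throughout and the Dini integral would dominate the divergent
  integral of \<open>e / r\<close>.
\<close>

lemma dini_modulus_small:
  assumes "dini_continuous_at u x" "e > 0"
  shows "\<exists>r>0. dini_modulus u x r < ennreal e"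
proof (rule ccontr)
  assume "\<not> (\<exists>r>0. dini_modulus u x r < ennreal e)"
  then have ge: "ennreal e \<le> dini_modulus u x r" if "r > 0" for r
    using that by (metis not_less)
  define I where "I = (\<integral>\<^sup>+r\<in>{0<..1}. (dini_modulus u x r / ennreal r) \<partial>lborel)"
  have lower: "ennreal (e * m) \<le> I" if m: "m > 0" for m
  proof -
    have "ennreal (e * m) = ennreal e * (\<integral>\<^sup>+r. ennreal (1 / r) * indicator {exp (- m)..1} r \<partial>lborel)"
      using m assms by (subst nn_integral_dlog_Icc) (auto simp: ennreal_mult ln_div)
    also have "\<dots> = (\<integral>\<^sup>+r. ennreal e * (ennreal (1 / r) * indicator {exp (- m)..1} r) \<partial>lborel)"
      by (rule nn_integral_cmult[symmetric]) measurable
    also have "\<dots> \<le> I"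
      unfolding I_def
    proof (rule nn_integral_mono)
      fix r :: real
      show "ennreal e * (ennreal (1 / r) * indicator {exp (- m)..1} r) \<le> dini_modulus u x r / ennreal r * indicator {0<..1} r"
      proof (cases "r \<in> {exp (- m)..1}")
        case True
        then have r: "r > 0" by (smt (verit) exp_gt_zero atLeastAtMost_iff)
        have "ennreal e * ennreal (1 / r) \<le> dini_modulus u x r * ennreal (1 / r)"
          by (intro mult_right_mono ge r) simp
        also have "\<dots> = dini_modulus u x r / ennreal r"
          using r by (simp add: divide_ennreal_def inverse_ennreal inverse_eq_divide)
        finally show ?thesis using True r by simp
      qed simp
    qed
    finally show ?thesis .
  qed
  have "I < \<infinity>" using assms by (simp add: I_def dini_continuous_at_iff)
  then obtain b where b: "I = ennreal b" "b \<ge> 0" by (cases I) auto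
  have "ennreal (e * ((b + 1) / e)) \<le> ennreal b"
    using lower[of "(b + 1) / e"] assms b by simp
  then show False using assms b by simp
qed

lemma dini_continuous_at_imp_isCont:
  assumes "dini_continuous_at u x" shows "isCont u x"
  unfolding continuous_at_eps_delta
proof (intro allI impI)
  fix e :: real assume "e > 0"
  then obtain r where r: "r > 0" "dini_modulus u x r < ennreal e"
    using dini_modulus_small[OF assms] by blast
  have "dist (u y) (u x) < e" if "dist y x < r" for y
  proof -
    have "ennreal \<bar>u x - u y\<bar> \<le> dini_modulus u x r"
      using that by (intro dini_modulus_upper) (simp add: dist_norm norm_minus_commute)
    then have "ennreal \<bar>u x - u y\<bar> < ennreal e" using r(2) by (rule le_less_trans)
    then show ?thesis using \<open>e > 0\<close> by (simp add: dist_real_def ennreal_less_iff abs_minus_commute)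
  qed
  with r show "\<exists>d>0. \<forall>x'. dist x' x < d \<longrightarrow> dist (u x') (u x) < e" by blast
qed

text \<open>
  Through continuity, elements of the Dini space are Borel measurable, so that Lebesgue measure may be
  replaced by its Borel restriction from here on.
\<close>

lemma dini_space_imp_continuous:
  assumes "u \<in> dini_space" shows "continuous_on UNIV u"
  using assms by (auto simp: dini_space_def continuous_on_eq_continuous_at intro: dini_continuous_at_imp_isCont)

lemma dini_space_imp_borel:
  assumes "u \<in> dini_space" shows "u \<in> borel_measurable borel"
  using dini_space_imp_continuous[OF assms] by (rule borel_measurable_continuous_onI)

lemma borel_imp_lebesgue: "f \<in> borel_measurable borel \<Longrightarrow> f \<in> borel_measurable lebesgue"
  by (simp add: measurable_completion)

lemma borel_measurable_integrand [measurable]: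
  assumes [measurable]: "u \<in> borel_measurable borel"
  shows "log_laplacian_integrand u x \<in> borel_measurable borel"
proof -
  have [measurable]: "ball x 1 \<in> sets borel" by simp
  show ?thesis unfolding log_laplacian_integrand_def[abs_def] by measurable
qed

lemma log_laplacian_converges_iff:
  assumes "u \<in> borel_measurable borel"
  shows "log_laplacian_converges u x \<longleftrightarrow> integrable lborel (log_laplacian_integrand u x)"
  using assms unfolding log_laplacian_converges_def by (intro integrable_completion) simp

text \<open>
  The cutoff radius is free, because a Kelvin transform may be unbounded near its centre, which can lie in
  the unit ball around \<open>x\<close>. Changing the cutoff from \<open>1\<close> to \<open>d\<close> costs the mass \<open>sphere_area n * ln (1 / d)\<close> of
  the kernel on an annulus.
\<close>

lemma log_laplacian_convergesI:
  fixes u :: "real ^ 'n \<Rightarrow> real"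
  assumes [measurable]: "u \<in> borel_measurable borel" and d: "0 < d" "d \<le> 1"
    and near: "(\<integral>\<^sup>+y. ennreal \<bar>u x - u y\<bar> * ennreal (1 / norm (x - y) ^ CARD('n)) * indicator (ball x d) y \<partial>lborel) < \<infinity>"
    and far: "(\<integral>\<^sup>+y. ennreal \<bar>u y\<bar> * ennreal (1 / norm (x - y) ^ CARD('n)) * indicator (- ball x d) y \<partial>lborel) < \<infinity>"
  shows "log_laplacian_converges u x"
proof -
  let ?K = "\<lambda>y. ennreal (1 / norm (x - y) ^ CARD('n))"
  have [measurable]: "ball x 1 \<in> sets borel" "ball x d \<in> sets borel" by simp_all
  have bound: "ennreal (norm (log_laplacian_integrand u x y)) \<le>
      ennreal \<bar>u x - u y\<bar> * ?K y * indicator (ball x d) y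
      + ennreal \<bar>u y\<bar> * ?K y * indicator (- ball x d) y
      + ennreal \<bar>u x\<bar> * (?K y * indicator (ball x 1 - ball x d) y)" for y
  proof -
    have eq: "norm (log_laplacian_integrand u x y) = \<bar>u x * indicator (ball x 1) y - u y\<bar> * (1 / norm (x - y) ^ CARD('n))"
      by (simp add: log_laplacian_integrand_def abs_mult)
    consider "y \<in> ball x d" | "y \<notin> ball x d" "y \<in> ball x 1" | "y \<notin> ball x 1" "y \<notin> ball x d" using d by fastforce
    then show ?thesis
    proof cases
      case 2
      have "\<bar>u x - u y\<bar> * (1 / norm (x - y) ^ CARD('n)) \<le> \<bar>u y\<bar> * (1 / norm (x - y) ^ CARD('n)) + \<bar>u x\<bar> * (1 / norm (x - y) ^ CARD('n))"
        unfolding distrib_right[symmetric] by (intro mult_right_mono) auto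
      then show ?thesis using 2 unfolding eq
        by (simp del: ennreal_plus mem_ball add: ennreal_plus[symmetric] flip: ennreal_mult)
    next
      case 1
      then show ?thesis using d unfolding eq by (auto simp flip: ennreal_mult)
    next
      case 3
      then show ?thesis unfolding eq by (auto simp flip: ennreal_mult)
    qed
  qed
  have "(\<integral>\<^sup>+y. ennreal (norm (log_laplacian_integrand u x y)) \<partial>lborel) \<le>
     (\<integral>\<^sup>+y. ennreal \<bar>u x - u y\<bar> * ?K y * indicator (ball x d) y
      + ennreal \<bar>u y\<bar> * ?K y * indicator (- ball x d) y
      + ennreal \<bar>u x\<bar> * (?K y * indicator (ball x 1 - ball x d) y) \<partial>lborel)"
    by (intro nn_integral_mono bound)
  also have "\<dots> = (\<integral>\<^sup>+y. ennreal \<bar>u x - u y\<bar> * ?K y * indicator (ball x d) y \<partial>lborel)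
      + (\<integral>\<^sup>+y. ennreal \<bar>u y\<bar> * ?K y * indicator (- ball x d) y \<partial>lborel)
      + ennreal \<bar>u x\<bar> * (\<integral>\<^sup>+y. ?K y * indicator (ball x 1 - ball x d) y \<partial>lborel)"
    by (simp add: nn_integral_add nn_integral_cmult)
  also have "\<dots> < \<infinity>"
    using near far d by (simp add: nn_integral_annulus ennreal_mult_less_top)
  finally show ?thesis
    by (simp add: log_laplacian_converges_iff integrable_iff_bounded)
qed

text \<open>
  In polar coordinates the surface factor \<open>t ^ (n - 1)\<close> turns the kernel \<open>1 / t ^ n\<close> into \<open>1 / t\<close>, which is the weight
  in the Dini condition.
\<close>

lemma dini_near_finite:
  fixes u :: "real ^ 'n \<Rightarrow> real"
  assumes "dini_continuous_at u x"
  shows "(\<integral>\<^sup>+y. ennreal \<bar>u x - u y\<bar> * ennreal (1 / norm (x - y) ^ CARD('n)) * indicator (ball x 1) y \<partial>lborel) < \<infinity>"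
proof -
  \<comment> \<open>Leaving out \<open>t = 0\<close> is harmless because \<open>\<bar>u x - u y\<bar>\<close> vanishes at \<open>y = x\<close>.\<close>
  let ?g = "\<lambda>t. dini_modulus u x t * ennreal (1 / t ^ CARD('n)) * indicator {0<..1} t"
  have "(\<integral>\<^sup>+y. ennreal \<bar>u x - u y\<bar> * ennreal (1 / norm (x - y) ^ CARD('n)) * indicator (ball x 1) y \<partial>lborel) \<le>
      (\<integral>\<^sup>+y. ?g (norm (x - y)) \<partial>lborel)"
  proof (rule nn_integral_mono)
    fix y
    show "ennreal \<bar>u x - u y\<bar> * ennreal (1 / norm (x - y) ^ CARD('n)) * indicator (ball x 1) y \<le> ?g (norm (x - y))"
      by (cases "y = x") (auto split: split_indicator simp: dist_norm intro!: mult_right_mono dini_modulus_upper)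
  qed
  also have "\<dots> = ennreal (sphere_area CARD('n)) * (\<integral>\<^sup>+t. ?g t * ennreal (t ^ (CARD('n) - 1)) * indicator {0..} t \<partial>lborel)"
    by (rule nn_integral_radial_about) measurable
  also have "(\<integral>\<^sup>+t. ?g t * ennreal (t ^ (CARD('n) - 1)) * indicator {0..} t \<partial>lborel)
     = (\<integral>\<^sup>+t\<in>{0<..1}. (dini_modulus u x t / ennreal t) \<partial>lborel)"
  proof (intro nn_integral_cong)
    fix t :: real
    have "ennreal (1 / t ^ CARD('n)) * ennreal (t ^ (CARD('n) - 1)) = inverse (ennreal t)" if "t > 0"
    proof -
      have "1 / t ^ CARD('n) * t ^ (CARD('n) - 1) = inverse t"
        unfolding inverse_eq_divide using that by (rule power_kernel_mult) simp
      then show ?thesis using that by (simp add: inverse_ennreal flip: ennreal_mult)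
    qed
    then show "?g t * ennreal (t ^ (CARD('n) - 1)) * indicator {0..} t = dini_modulus u x t / ennreal t * indicator {0<..1} t"
      by (auto split: split_indicator simp: divide_ennreal_def mult.assoc)
  qed
  also have "ennreal (sphere_area CARD('n)) * \<dots> < \<infinity>"
    using assms by (simp add: dini_continuous_at_iff ennreal_mult_less_top)
  finally show ?thesis .
qed

lemma L10_space_iff:
  fixes u :: "real ^ 'n \<Rightarrow> real"
  assumes [measurable]: "u \<in> borel_measurable borel"
  shows "u \<in> L10_space \<longleftrightarrow> (\<integral>\<^sup>+x. ennreal (\<bar>u x\<bar> / (1 + norm x ^ CARD('n))) \<partial>lborel) < \<infinity>"
proof -
  have m: "(\<lambda>x. \<bar>u x\<bar> / (1 + norm x ^ CARD('n))) \<in> borel_measurable borel" by measurable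
  show ?thesis
    using borel_imp_lebesgue[OF assms] borel_imp_lebesgue[OF m]
    by (simp add: L10_space_def integrable_iff_bounded abs_of_nonneg nn_integral_completion)
qed

lemma power_add_le_two_power:
  fixes a b :: real
  assumes "0 \<le> a" "0 \<le> b"
  shows "(a + b) ^ n \<le> 2 ^ n * (a ^ n + b ^ n)"
proof -
  have "(a + b) ^ n \<le> (2 * max a b) ^ n"
    using assms by (intro power_mono) auto
  also have "\<dots> = 2 ^ n * max a b ^ n" by (simp add: power_mult_distrib)
  also have "\<dots> \<le> 2 ^ n * (a ^ n + b ^ n)"
    using assms by (intro mult_left_mono) (auto simp: max_def)
  finally show ?thesis .
qed

text \<open>
  Away from \<open>x\<close>, the kernel \<open>1 / \<bar>x - y\<bar> ^ n\<close> is bounded by a constant times the weight \<open>1 / (1 + \<bar>y\<bar> ^ n)\<close>.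
\<close>

lemma L10_far_finite:
  fixes u :: "real ^ 'n \<Rightarrow> real"
  assumes [measurable]: "u \<in> borel_measurable borel" and L10: "u \<in> L10_space"
  shows "(\<integral>\<^sup>+y. ennreal \<bar>u y\<bar> * ennreal (1 / norm (x - y) ^ CARD('n)) * indicator (- ball x 1) y \<partial>lborel) < \<infinity>"
proof -
  define K where "K = 1 + 2 ^ CARD('n) * norm x ^ CARD('n) + 2 ^ CARD('n)"
  have K: "K > 0" unfolding K_def by (intro add_pos_pos add_pos_nonneg) auto
  have "(\<integral>\<^sup>+y. ennreal \<bar>u y\<bar> * ennreal (1 / norm (x - y) ^ CARD('n)) * indicator (- ball x 1) y \<partial>lborel) \<le>
    (\<integral>\<^sup>+y. ennreal K * ennreal (\<bar>u y\<bar> / (1 + norm y ^ CARD('n))) \<partial>lborel)"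
  proof (rule nn_integral_mono)
    fix y
    show "ennreal \<bar>u y\<bar> * ennreal (1 / norm (x - y) ^ CARD('n)) * indicator (- ball x 1) y \<le> ennreal K * ennreal (\<bar>u y\<bar> / (1 + norm y ^ CARD('n)))"
    proof (cases "y \<in> ball x 1")
      case False
      define d where "d = norm (x - y)"
      have d: "d \<ge> 1" using False by (simp add: d_def dist_norm)
      have "norm y \<le> norm x + d" unfolding d_def by norm
      then have "norm y ^ CARD('n) \<le> (norm x + d) ^ CARD('n)" by (intro power_mono) auto
      also have "\<dots> \<le> 2 ^ CARD('n) * (norm x ^ CARD('n) + d ^ CARD('n))"
        using d by (intro power_add_le_two_power) auto
      finally have "1 + norm y ^ CARD('n) \<le> 1 * (1 + 2 ^ CARD('n) * norm x ^ CARD('n)) + 2 ^ CARD('n) * d ^ CARD('n)"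
        by (simp add: algebra_simps)
      also have "\<dots> \<le> d ^ CARD('n) * (1 + 2 ^ CARD('n) * norm x ^ CARD('n)) + 2 ^ CARD('n) * d ^ CARD('n)"
        using d by (intro add_right_mono mult_right_mono one_le_power) auto
      also have "\<dots> = K * d ^ CARD('n)" by (simp add: K_def algebra_simps)
      finally have "1 / d ^ CARD('n) \<le> K / (1 + norm y ^ CARD('n))"
        using d by (simp add: field_simps add_pos_nonneg)
      then have "\<bar>u y\<bar> * (1 / d ^ CARD('n)) \<le> \<bar>u y\<bar> * (K / (1 + norm y ^ CARD('n)))"
        by (intro mult_left_mono) auto
      then show ?thesis using False K
        by (simp add: d_def mult.commute flip: ennreal_mult)
    qed simp
  qed
  also have "\<dots> = ennreal K * (\<integral>\<^sup>+y. ennreal (\<bar>u y\<bar> / (1 + norm y ^ CARD('n))) \<partial>lborel)"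
    by (rule nn_integral_cmult) measurable
  also have "\<dots> < \<infinity>" using L10 by (simp add: L10_space_iff ennreal_mult_less_top)
  finally show ?thesis .
qed

lemma dini_L10_converges:
  assumes "u \<in> borel_measurable borel" "dini_continuous_at u x" "u \<in> L10_space"
  shows "log_laplacian_converges u x"
  using assms by (intro log_laplacian_convergesI[where d=1] dini_near_finite L10_far_finite) auto

definition tail_integral :: "(real ^ 'n \<Rightarrow> real) \<Rightarrow> real ^ 'n \<Rightarrow> real \<Rightarrow> real" where
  "tail_integral u x \<epsilon> = (LINT y|lborel. indicator (- ball x \<epsilon>) y * (u y / norm (x - y) ^ CARD('n)))"

lemma annulus_integral:
  fixes x :: "real ^ 'n"
  assumes "0 < s" "s \<le> t"
  shows "integrable lborel (\<lambda>y. indicator (ball x t - ball x s) y / norm (x - y) ^ CARD('n))"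
    and "(LINT y|lborel. indicator (ball x t - ball x s) y / norm (x - y) ^ CARD('n)) = sphere_area CARD('n) * ln (t / s)"
proof -
  have [measurable]: "ball x t \<in> sets borel" "ball x s \<in> sets borel" by simp_all
  have "has_bochner_integral lborel (\<lambda>y. indicator (ball x t - ball x s) y / norm (x - y) ^ CARD('n)) (sphere_area CARD('n) * ln (t / s))"
  proof (rule has_bochner_integral_nn_integral)
    have "(\<integral>\<^sup>+y. ennreal (indicator (ball x t - ball x s) y / norm (x - y) ^ CARD('n)) \<partial>lborel) =
      (\<integral>\<^sup>+y. ennreal (1 / norm (x - y) ^ CARD('n)) * indicator (ball x t - ball x s) y \<partial>lborel)"
      by (intro nn_integral_cong) (auto split: split_indicator)
    then show "(\<integral>\<^sup>+y. ennreal (indicator (ball x t - ball x s) y / norm (x - y) ^ CARD('n)) \<partial>lborel) = ennreal (sphere_area CARD('n) * ln (t / s))"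
      using nn_integral_annulus[OF assms, of x] by simp
    show "0 \<le> sphere_area CARD('n) * ln (t / s)" using assms by simp
  qed (auto intro!: divide_nonneg_nonneg)
  then show "integrable lborel (\<lambda>y. indicator (ball x t - ball x s) y / norm (x - y) ^ CARD('n))"
    and "(LINT y|lborel. indicator (ball x t - ball x s) y / norm (x - y) ^ CARD('n)) = sphere_area CARD('n) * ln (t / s)"
    by (auto simp: has_bochner_integral_iff)
qed

lemma tail_integral_small:
  fixes u :: "real ^ 'n \<Rightarrow> real"
  assumes [measurable]: "u \<in> borel_measurable borel" and conv: "log_laplacian_converges u x"
    and e: "0 < \<epsilon>" "\<epsilon> \<le> 1"
  shows "integrable lborel (\<lambda>y. indicator (- ball x \<epsilon>) y * (u y / norm (x - y) ^ CARD('n)))"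
    and "(LINT y|lborel. indicator (- ball x \<epsilon>) y * log_laplacian_integrand u x y) =
      u x * (sphere_area CARD('n) * ln (1 / \<epsilon>)) - tail_integral u x \<epsilon>"
proof -
  have [measurable]: "ball x \<epsilon> \<in> sets borel" by simp
  have eq: "indicator (- ball x \<epsilon>) y * (u y / norm (x - y) ^ CARD('n)) =
    u x * (indicator (ball x 1 - ball x \<epsilon>) y / norm (x - y) ^ CARD('n)) - indicator (- ball x \<epsilon>) y * log_laplacian_integrand u x y" for y
    by (auto simp: log_laplacian_integrand_def diff_divide_distrib split: split_indicator)
  have i1: "integrable lborel (\<lambda>y. u x * (indicator (ball x 1 - ball x \<epsilon>) y / norm (x - y) ^ CARD('n)))"
    using e by (intro integrable_mult_right annulus_integral) auto
  have i2: "integrable lborel (\<lambda>y. indicator (- ball x \<epsilon>) y * log_laplacian_integrand u x y)"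
    using conv integrable_mult_indicator[of "- ball x \<epsilon>" lborel "log_laplacian_integrand u x"]
    by (simp add: log_laplacian_converges_iff)
  show "integrable lborel (\<lambda>y. indicator (- ball x \<epsilon>) y * (u y / norm (x - y) ^ CARD('n)))"
    unfolding eq by (intro Bochner_Integration.integrable_diff i1 i2)
  have "tail_integral u x \<epsilon> = u x * (sphere_area CARD('n) * ln (1 / \<epsilon>)) -
     (LINT y|lborel. indicator (- ball x \<epsilon>) y * log_laplacian_integrand u x y)"
    unfolding tail_integral_def eq Bochner_Integration.integral_diff[OF i1 i2]
    using annulus_integral(2)[of \<epsilon> 1 x] e by (subst integral_mult_right_zero) simp
  then show "(LINT y|lborel. indicator (- ball x \<epsilon>) y * log_laplacian_integrand u x y) =
      u x * (sphere_area CARD('n) * ln (1 / \<epsilon>)) - tail_integral u x \<epsilon>" by simp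
qed

text \<open>
  The singular integral as a renormalised limit of tails. In this form the unit ball of the definition
  has disappeared, so the effect of a change of variables can be read off from its effect on tails;
  rescaling the cutoff shifts the logarithm and produces the correction terms.
\<close>

lemma log_laplacian_as_limit:
  fixes u :: "real ^ 'n \<Rightarrow> real"
  assumes [measurable]: "u \<in> borel_measurable borel" and conv: "log_laplacian_converges u x"
  shows "((\<lambda>\<epsilon>. u x * (sphere_area CARD('n) * ln (1 / \<epsilon>)) - tail_integral u x \<epsilon>) \<longlongrightarrow>
     (LINT y|lebesgue. log_laplacian_integrand u x y)) (at_right 0)"
proof -
  let ?I = "log_laplacian_integrand u x"
  have int: "integrable lborel ?I" using conv by (simp add: log_laplacian_converges_iff)
  have "((\<lambda>\<epsilon>. LINT y|lborel. indicator (- ball x \<epsilon>) y * ?I y) \<longlongrightarrow> (LINT y|lborel. ?I y)) (at_right 0)"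
    unfolding tendsto_at_iff_sequentially comp_def
  proof (intro allI impI)
    fix X :: "nat \<Rightarrow> real" assume X: "\<forall>i. X i \<in> {0<..} - {0}" "X \<longlonglongrightarrow> 0"
    show "(\<lambda>i. LINT y|lborel. indicator (- ball x (X i)) y * ?I y) \<longlonglongrightarrow> (LINT y|lborel. ?I y)"
    proof (rule integral_dominated_convergence[where w="\<lambda>y. norm (?I y)"])
      show "AE y in lborel. (\<lambda>i. indicator (- ball x (X i)) y * ?I y) \<longlonglongrightarrow> ?I y"
        using AE_lborel_singleton[of x]
      proof eventually_elim
        case (elim y)
        have "\<forall>\<^sub>F i in sequentially. X i < dist x y"
          using X elim by (intro order_tendstoD) auto
        then have "\<forall>\<^sub>F i in sequentially. indicator (- ball x (X i)) y * ?I y = ?I y"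
          by eventually_elim simp
        then show ?case by (rule tendsto_eventually)
      qed
      show "(\<lambda>y. indicator (- ball x (X i)) y * ?I y) \<in> borel_measurable lborel" for i
      proof -
        have [measurable]: "ball x (X i) \<in> sets borel" by simp
        show ?thesis by measurable
      qed
    qed (use int in \<open>auto split: split_indicator\<close>)
  qed
  moreover have "\<forall>\<^sub>F \<epsilon> in at_right 0. (LINT y|lborel. indicator (- ball x \<epsilon>) y * ?I y) =
     u x * (sphere_area CARD('n) * ln (1 / \<epsilon>)) - tail_integral u x \<epsilon>"
    using eventually_at_right_real[OF zero_less_one]
    by eventually_elim (use tail_integral_small(2)[OF _ conv] in auto)
  ultimately show ?thesis
    by (simp add: integral_completion Lim_transform_eventually)
qed

section \<open>Affine changes of variables\<close>

lemma lborel_integral_affine: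
  fixes f :: "'a::euclidean_space \<Rightarrow> real"
  assumes [measurable]: "f \<in> borel_measurable borel" and s: "s \<noteq> 0"
  shows "(LINT x|lborel. f x) = \<bar>s\<bar> ^ DIM('a) * (LINT x|lborel. f (s *\<^sub>R x + b))"
proof -
  have "(LINT x|lborel. f x) = (LINT x|density (distr lborel borel (\<lambda>x. b + s *\<^sub>R x)) (\<lambda>_. ennreal (\<bar>s\<bar> ^ DIM('a))). f x)"
    using lborel_affine[OF s, of b] by simp
  then show ?thesis
    by (simp add: integral_density integral_distr add.commute)
qed

lemma tail_integral_affine:
  fixes u :: "real ^ 'n \<Rightarrow> real"
  assumes [measurable]: "u \<in> borel_measurable borel" and s: "s > 0"
  shows "tail_integral (\<lambda>x. k * u (s *\<^sub>R x + b)) x \<epsilon> = k * tail_integral u (s *\<^sub>R x + b) (s * \<epsilon>)"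
proof -
  let ?q = "s *\<^sub>R x + b"
  let ?f = "\<lambda>z. indicator (- ball ?q (s * \<epsilon>)) z * (u z / norm (?q - z) ^ CARD('n))"
  have [measurable]: "ball ?q (s * \<epsilon>) \<in> sets borel" by simp
  have f: "s ^ CARD('n) * ?f (s *\<^sub>R y + b) = indicator (- ball x \<epsilon>) y * (u (s *\<^sub>R y + b) / norm (x - y) ^ CARD('n))" for y
  proof -
    have "norm (?q - (s *\<^sub>R y + b)) = s * norm (x - y)"
      using s by (simp flip: scaleR_diff_right)
    then show ?thesis using s
      by (simp add: dist_norm power_mult_distrib indicator_def)
  qed
  have "tail_integral u ?q (s * \<epsilon>) = s ^ CARD('n) * (LINT y|lborel. ?f (s *\<^sub>R y + b))"
    unfolding tail_integral_def using s by (subst lborel_integral_affine[where s=s and b=b]) auto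
  also have "\<dots> = (LINT y|lborel. s ^ CARD('n) * ?f (s *\<^sub>R y + b))"
    by (rule integral_mult_right_zero[symmetric])
  also have "\<dots> = (LINT y|lborel. indicator (- ball x \<epsilon>) y * (u (s *\<^sub>R y + b) / norm (x - y) ^ CARD('n)))"
    unfolding f ..
  finally have "k * tail_integral u ?q (s * \<epsilon>) =
      (LINT y|lborel. k * (indicator (- ball x \<epsilon>) y * (u (s *\<^sub>R y + b) / norm (x - y) ^ CARD('n))))"
    by (simp only: integral_mult_right_zero)
  then show ?thesis
    unfolding tail_integral_def by (simp add: mult.left_commute)
qed

text \<open>
  A dilation by \<open>s\<close> changes the cutoff \<open>\<epsilon>\<close> to \<open>s \<epsilon>\<close>, hence the renormalising logarithm by \<open>ln s\<close>; the factor \<open>2\<close>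
  is \<open>c_const n * sphere_area n\<close>.
\<close>

lemma log_laplacian_affine:
  fixes u :: "real ^ 'n \<Rightarrow> real"
  assumes [measurable]: "u \<in> borel_measurable borel" and s: "s > 0"
    and conv_u: "log_laplacian_converges u (s *\<^sub>R x + b)"
    and conv_v: "log_laplacian_converges (\<lambda>x. k * u (s *\<^sub>R x + b)) x"
  shows "log_laplacian (\<lambda>x. k * u (s *\<^sub>R x + b)) x
    = k * (log_laplacian u (s *\<^sub>R x + b) + 2 * ln s * u (s *\<^sub>R x + b))"
proof -
  let ?q = "s *\<^sub>R x + b" and ?v = "\<lambda>x. k * u (s *\<^sub>R x + b)" and ?\<omega> = "sphere_area CARD('n)"
  let ?G = "\<lambda>\<epsilon>. u ?q * (?\<omega> * ln (1 / \<epsilon>)) - tail_integral u ?q \<epsilon>"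
  let ?I = "LINT y|lebesgue. log_laplacian_integrand u ?q y"
  have "(?G \<longlongrightarrow> ?I) (at_right 0)"
    by (rule log_laplacian_as_limit) (use conv_u in auto)
  moreover have "filterlim (\<lambda>\<epsilon>. s * \<epsilon>) (at_right 0) (at_right 0)"
    unfolding filterlim_at using s
    by (auto intro!: tendsto_eq_intros eventually_at_rightI[of 0 1])
  ultimately have "((\<lambda>\<epsilon>. ?G (s * \<epsilon>)) \<longlongrightarrow> ?I) (at_right 0)"
    by (rule filterlim_compose)
  then have "((\<lambda>\<epsilon>. k * (?G (s * \<epsilon>) + u ?q * (?\<omega> * ln s))) \<longlongrightarrow> k * (?I + u ?q * (?\<omega> * ln s))) (at_right 0)"
    by (intro tendsto_intros)
  moreover have "\<forall>\<^sub>F \<epsilon> in at_right 0. k * (?G (s * \<epsilon>) + u ?q * (?\<omega> * ln s)) =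
     ?v x * (?\<omega> * ln (1 / \<epsilon>)) - tail_integral ?v x \<epsilon>"
    using eventually_at_right_less[of 0]
    by eventually_elim
      (use s in \<open>simp only: tail_integral_affine[OF assms(1) s], simp add: ln_div ln_mult algebra_simps\<close>)
  ultimately have "((\<lambda>\<epsilon>. ?v x * (?\<omega> * ln (1 / \<epsilon>)) - tail_integral ?v x \<epsilon>) \<longlongrightarrow> k * (?I + u ?q * (?\<omega> * ln s))) (at_right 0)"
    by (rule Lim_transform_eventually)
  moreover have "((\<lambda>\<epsilon>. ?v x * (?\<omega> * ln (1 / \<epsilon>)) - tail_integral ?v x \<epsilon>) \<longlongrightarrow> (LINT y|lebesgue. log_laplacian_integrand ?v x y)) (at_right 0)"
    by (rule log_laplacian_as_limit) (use conv_v in auto)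
  ultimately have eq: "(LINT y|lebesgue. log_laplacian_integrand ?v x y) = k * (?I + u ?q * (?\<omega> * ln s))"
    by (intro tendsto_unique[OF _ _ _, rotated]) auto
  have "log_laplacian ?v x = k * (log_laplacian u ?q + c_const CARD('n) * ?\<omega> * ln s * u ?q)"
    unfolding log_laplacian_def eq by (simp add: algebra_simps)
  then show ?thesis by (simp add: c_const_sphere_area)
qed

lemma dini_modulus_finite:
  assumes "continuous_on UNIV u" shows "dini_modulus u x r < \<infinity>"
proof -
  have "compact ((\<lambda>y. \<bar>u y - u x\<bar>) ` cball x r)"
    by (intro compact_continuous_image continuous_intros continuous_on_subset[OF assms]) auto
  then obtain B where B: "\<And>y. y \<in> cball x r \<Longrightarrow> \<bar>u y - u x\<bar> \<le> B"
    by (force dest!: compact_imp_bounded simp: bounded_iff)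
  have "dini_modulus u x r \<le> ennreal B"
    unfolding dini_modulus_def by (intro SUP_least ennreal_leI B)
  then show ?thesis by (simp add: le_less_trans[OF _ ennreal_less_top])
qed

text \<open>
  The modulus at radius \<open>r\<close> is controlled by that of \<open>u\<close> at radius \<open>s r\<close>. For \<open>s > 1\<close> this uses radii in \<open>{1..s}\<close>, on
  which the Dini condition gives no information, but there the modulus is finite since \<open>u\<close> is
  continuous.
\<close>

lemma dini_space_affine:
  fixes u :: "real ^ 'n \<Rightarrow> real"
  assumes u: "u \<in> dini_space" and k: "k > 0" and s: "s > 0"
  shows "(\<lambda>x. k * u (s *\<^sub>R x + b)) \<in> dini_space"
  unfolding dini_space_def
proof (intro CollectI allI)
  fix x
  let ?q = "s *\<^sub>R x + b" and ?v = "\<lambda>x. k * u (s *\<^sub>R x + b)"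
  let ?w = "dini_modulus u ?q"
  have mod: "dini_modulus ?v x r \<le> ennreal k * ?w (s * r)" for r
    unfolding dini_modulus_def[of ?v]
  proof (rule SUP_least)
    fix y assume y: "y \<in> cball x r"
    have "norm (?q - (s *\<^sub>R y + b)) \<le> s * r"
      using s y by (simp add: dist_norm flip: scaleR_diff_right)
    then have "ennreal k * ennreal \<bar>u ?q - u (s *\<^sub>R y + b)\<bar> \<le> ennreal k * ?w (s * r)"
      by (intro mult_left_mono dini_modulus_upper) auto
    also have "ennreal k * ennreal \<bar>u ?q - u (s *\<^sub>R y + b)\<bar> = ennreal \<bar>?v y - ?v x\<bar>"
      using k by (subst abs_minus_commute) (simp add: abs_mult flip: ennreal_mult right_diff_distrib)
    finally show "ennreal \<bar>?v y - ?v x\<bar> \<le> ennreal k * ?w (s * r)" .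
  qed
  let ?f = "\<lambda>t. ?w t / ennreal t * indicator {0<..s} t"
  have "(\<integral>\<^sup>+t. ?f t \<partial>lborel) \<le> (\<integral>\<^sup>+t. ?w t / ennreal t * indicator {0<..1} t + ?w s * indicator {1..s} t \<partial>lborel)"
  proof (rule nn_integral_mono)
    fix t
    have "?w t / ennreal t \<le> ?w s" if t: "1 \<le> t" "t \<le> s"
    proof -
      have "inverse (ennreal t) \<le> 1"
        using t by (simp add: inverse_ennreal inverse_eq_divide)
      then have "?w t * inverse (ennreal t) \<le> ?w s * 1"
        using t by (intro mult_mono monoD[OF dini_modulus_mono]) auto
      then show ?thesis by (simp add: divide_ennreal_def)
    qed
    then show "?f t \<le> ?w t / ennreal t * indicator {0<..1} t + ?w s * indicator {1..s} t"
      by (auto split: split_indicator simp: add_increasing2)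
  qed
  also have "\<dots> = (\<integral>\<^sup>+t\<in>{0<..1}. (?w t / ennreal t) \<partial>lborel) + ?w s * emeasure lborel {1..s}"
    by (simp add: nn_integral_add nn_integral_cmult)
  also have "\<dots> < \<infinity>"
    using u dini_modulus_finite[OF dini_space_imp_continuous[OF u], of ?q s]
    by (auto simp: dini_space_def dini_continuous_at_iff ennreal_mult_less_top emeasure_lborel_Icc_eq)
  finally have fin: "(\<integral>\<^sup>+t. ?f t \<partial>lborel) < \<infinity>" .
  have "(\<integral>\<^sup>+r\<in>{0<..1}. (dini_modulus ?v x r / ennreal r) \<partial>lborel) \<le> (\<integral>\<^sup>+r. ennreal k * (ennreal s * ?f (0 + s * r)) \<partial>lborel)"
  proof (rule nn_integral_mono)
    fix r :: real
    have "dini_modulus ?v x r / ennreal r \<le> ennreal k * (ennreal s * (?w (s * r) / ennreal (s * r)))" if "0 < r"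
    proof -
      have "dini_modulus ?v x r / ennreal r \<le> (ennreal k * ?w (s * r)) / ennreal r"
        by (intro divide_right_mono_ennreal mod)
      also have "\<dots> = ennreal k * (ennreal s * (?w (s * r) / ennreal (s * r)))"
      proof -
        have "ennreal s * inverse (ennreal (s * r)) = inverse (ennreal r)"
          using s that by (simp add: inverse_ennreal flip: ennreal_mult)
        then show ?thesis
          by (metis (no_types, opaque_lifting) divide_ennreal_def mult.assoc mult.commute)
      qed
      finally show ?thesis .
    qed
    moreover have "indicator {0<..s} (0 + s * r) = (indicator {0<..1} r :: ennreal)"
      using s by (auto simp: indicator_def zero_less_mult_iff)
    ultimately show "dini_modulus ?v x r / ennreal r * indicator {0<..1} r \<le> ennreal k * (ennreal s * ?f (0 + s * r))"
      by (cases "r \<in> {0<..1}") simp_all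
  qed
  also have "\<dots> = ennreal k * (ennreal s * (\<integral>\<^sup>+r. ?f (0 + s * r) \<partial>lborel))"
    by (simp add: nn_integral_cmult)
  also have "ennreal s * (\<integral>\<^sup>+r. ?f (0 + s * r) \<partial>lborel) = (\<integral>\<^sup>+t. ?f t \<partial>lborel)"
    using s by (subst nn_integral_real_affine[of ?f s 0]) auto
  also have "ennreal k * \<dots> < \<infinity>" using fin by (simp add: ennreal_mult_less_top)
  finally show "dini_continuous_at ?v x" by (simp add: dini_continuous_at_iff)
qed

lemma L10_space_affine:
  fixes u :: "real ^ 'n \<Rightarrow> real"
  assumes [measurable]: "u \<in> borel_measurable borel" and u: "u \<in> L10_space" and s: "s > 0"
  shows "(\<lambda>x. k * u (s *\<^sub>R x + b)) \<in> L10_space"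
proof -
  let ?f = "\<lambda>y. ennreal (\<bar>u y\<bar> / (1 + norm y ^ CARD('n)))"
  define K where "K = 1 + 2 ^ CARD('n) * (s ^ CARD('n) + norm b ^ CARD('n))"
  have K: "K > 0" unfolding K_def using s by (intro add_pos_nonneg) auto
  have "ennreal (s ^ CARD('n)) * (\<integral>\<^sup>+x. ?f (s *\<^sub>R x + b) \<partial>lborel) = (\<integral>\<^sup>+x. ?f x \<partial>lborel)"
    using s by (subst nn_integral_lborel_affine[of ?f s b]) auto
  also have "\<dots> < \<infinity>" using u by (simp add: L10_space_iff)
  finally have fin: "(\<integral>\<^sup>+x. ?f (s *\<^sub>R x + b) \<partial>lborel) < \<infinity>"
    using s by (auto simp: ennreal_mult_less_top)
  have "(\<integral>\<^sup>+x. ennreal (\<bar>k * u (s *\<^sub>R x + b)\<bar> / (1 + norm x ^ CARD('n))) \<partial>lborel) \<le>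
     (\<integral>\<^sup>+x. ennreal (\<bar>k\<bar> * K) * ?f (s *\<^sub>R x + b) \<partial>lborel)"
  proof (rule nn_integral_mono)
    fix x
    let ?y = "s *\<^sub>R x + b"
    have "norm ?y \<le> s * norm x + norm b"
      using s norm_triangle_ineq[of "s *\<^sub>R x" b] by simp
    then have "norm ?y ^ CARD('n) \<le> (s * norm x + norm b) ^ CARD('n)" by (intro power_mono) auto
    also have "\<dots> \<le> 2 ^ CARD('n) * ((s * norm x) ^ CARD('n) + norm b ^ CARD('n))"
      using s by (intro power_add_le_two_power) auto
    finally have "1 + norm ?y ^ CARD('n) \<le> 1 + 2 ^ CARD('n) * (s ^ CARD('n) * norm x ^ CARD('n) + norm b ^ CARD('n))"
      by (simp add: power_mult_distrib)
    also have "\<dots> \<le> 1 + 2 ^ CARD('n) * (s ^ CARD('n) * norm x ^ CARD('n) + norm b ^ CARD('n))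
       + (2 ^ CARD('n) * s ^ CARD('n) + (1 + 2 ^ CARD('n) * norm b ^ CARD('n)) * norm x ^ CARD('n))"
      using s by simp
    also have "\<dots> = K * (1 + norm x ^ CARD('n))"
      by (simp add: K_def algebra_simps)
    finally have "1 / (1 + norm x ^ CARD('n)) \<le> K / (1 + norm ?y ^ CARD('n))"
      by (simp add: field_simps add_pos_nonneg)
    then have "\<bar>k * u ?y\<bar> * (1 / (1 + norm x ^ CARD('n))) \<le> \<bar>k * u ?y\<bar> * (K / (1 + norm ?y ^ CARD('n)))"
      by (intro mult_left_mono) auto
    then show "ennreal (\<bar>k * u ?y\<bar> / (1 + norm x ^ CARD('n))) \<le> ennreal (\<bar>k\<bar> * K) * ?f ?y"
      using K by (subst ennreal_mult[symmetric]) (auto simp: abs_mult mult_ac add_nonneg_nonneg intro!: ennreal_leI)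
  qed
  also have "\<dots> = ennreal (\<bar>k\<bar> * K) * (\<integral>\<^sup>+x. ?f (s *\<^sub>R x + b) \<partial>lborel)"
    by (rule nn_integral_cmult) measurable
  also have "\<dots> < \<infinity>" using fin by (simp add: ennreal_mult_less_top)
  finally show ?thesis by (simp add: L10_space_iff)
qed

text \<open>
  Translation and multiplication (\<open>s = 1\<close>) and the \<open>L\<^sup>2\<close>-preserving dilation (\<open>k = s powr (n / 2)\<close>) are both
  instances. The factor \<open>k\<close> enters through \<open>ln (k u) = ln k + ln u\<close> where \<open>u > 0\<close>, and where \<open>u = 0\<close> both
  sides vanish.
\<close>

lemma log_eq_solution_affine:
  fixes u :: "real ^ 'n \<Rightarrow> real"
  assumes sol: "log_eq_solution T u" and k: "k > 0" and s: "s > 0"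
  shows "log_eq_solution (T + 4 / real CARD('n) * ln k - 2 * ln s) (\<lambda>x. k * u (s *\<^sub>R x + b))"
proof -
  let ?v = "\<lambda>x. k * u (s *\<^sub>R x + b)"
  have u: "u \<in> dini_space" "u \<in> L10_space" "\<And>x. 0 \<le> u x" "\<And>x. satisfies_log_eq_at T u x"
    using sol by (auto simp: log_eq_solution_def)
  have [measurable]: "u \<in> borel_measurable borel" by (rule dini_space_imp_borel) fact
  have v: "?v \<in> dini_space" "?v \<in> L10_space"
    using u k s by (auto intro: dini_space_affine L10_space_affine)
  have "satisfies_log_eq_at (T + 4 / real CARD('n) * ln k - 2 * ln s) ?v x" for x
  proof -
    let ?q = "s *\<^sub>R x + b"
    have "log_laplacian_converges u ?q"
      using u(1,2) by (intro dini_L10_converges) (auto simp: dini_space_def)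
    moreover have "log_laplacian_converges ?v x"
      using v by (intro dini_L10_converges) (auto simp: dini_space_def)
    ultimately have Lv: "log_laplacian ?v x = k * (log_laplacian u ?q + 2 * ln s * u ?q)"
      using s by (intro log_laplacian_affine) simp_all
    define a where "a = 4 / real CARD('n)"
    have Lu: "log_laplacian u ?q = a * (u ?q * ln (u ?q)) - T * u ?q"
      using u(4)[of ?q] by (simp add: satisfies_log_eq_at_def a_def)
    have ln_ku: "k * u ?q * ln (k * u ?q) = k * u ?q * (ln k + ln (u ?q))"
      using u(3)[of ?q] k by (cases "u ?q = 0") (auto simp: ln_mult)
    show ?thesis
      unfolding satisfies_log_eq_at_def a_def[symmetric] Lv Lu ln_ku by (simp add: algebra_simps)
  qed
  then show ?thesis
    using v u(3) k by (simp add: log_eq_solution_def)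
qed

lemma L2_scaling:
  fixes u :: "real ^ 'n \<Rightarrow> real"
  assumes [measurable]: "u \<in> borel_measurable borel" and u: "u \<in> L2_space" and l: "l > 0"
  defines "v \<equiv> \<lambda>x. l powr (- (real CARD('n) / 2)) * u (inverse l *\<^sub>R x)"
  shows "v \<in> L2_space" "L2_norm v = L2_norm u"
proof -
  have [measurable]: "v \<in> borel_measurable borel" unfolding v_def by measurable
  have v2: "\<bar>v x\<bar>\<^sup>2 = inverse l ^ CARD('n) * \<bar>u (inverse l *\<^sub>R x)\<bar>\<^sup>2" for x
  proof -
    have "(l powr (- (real CARD('n) / 2)))\<^sup>2 = l powr (- real CARD('n))"
      by (simp add: power2_eq_square flip: powr_add)
    also have "\<dots> = inverse l ^ CARD('n)"
      using l by (simp add: powr_minus powr_realpow power_inverse)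
    finally show ?thesis by (simp add: v_def power_mult_distrib)
  qed
  have eq: "(\<integral>\<^sup>+x. ennreal (\<bar>v x\<bar>\<^sup>2) \<partial>lborel) = (\<integral>\<^sup>+x. ennreal (\<bar>u x\<bar>\<^sup>2) \<partial>lborel)"
    unfolding v2 using l
    by (subst (2) nn_integral_lborel_affine[where s="inverse l" and b=0]) (simp_all add: ennreal_mult nn_integral_cmult)
  have "(\<integral>\<^sup>+x. ennreal (\<bar>u x\<bar>\<^sup>2) \<partial>lborel) < \<infinity>"
    using u by (simp add: L2_space_def integrable_iff_bounded nn_integral_completion)
  then show "v \<in> L2_space"
    using eq by (simp add: L2_space_def integrable_iff_bounded borel_imp_lebesgue nn_integral_completion)
  show "L2_norm v = L2_norm u"
    unfolding L2_norm_def using eq by (simp add: integral_completion integral_eq_nn_integral)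
qed

section \<open>The Kelvin transform\<close>

text \<open>
  The same tail for nonnegative \<open>u\<close> with values in \<open>[0, \<infinity>]\<close>, which can be compared and transformed before
  its finiteness is known.
\<close>

definition nn_tail :: "(real ^ 'n \<Rightarrow> real) \<Rightarrow> real ^ 'n \<Rightarrow> real \<Rightarrow> ennreal" where
  "nn_tail u x \<epsilon> = (\<integral>\<^sup>+y. ennreal (u y) * ennreal (1 / norm (x - y) ^ CARD('n)) * indicator (- ball x \<epsilon>) y \<partial>lborel)"

lemma nn_tail_eq_tail_integral:
  fixes u :: "real ^ 'n \<Rightarrow> real"
  assumes u: "u \<in> borel_measurable borel" "\<And>y. 0 \<le> u y"
    and conv: "log_laplacian_converges u x" and e: "0 < \<epsilon>" "\<epsilon> \<le> 1"
  shows "nn_tail u x \<epsilon> = ennreal (tail_integral u x \<epsilon>)" "0 \<le> tail_integral u x \<epsilon>"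
proof -
  have "nn_tail u x \<epsilon> = (\<integral>\<^sup>+y. ennreal (indicator (- ball x \<epsilon>) y * (u y / norm (x - y) ^ CARD('n))) \<partial>lborel)"
    unfolding nn_tail_def
    by (intro nn_integral_cong) (auto split: split_indicator simp: u(2) simp flip: ennreal_mult)
  also have "\<dots> = ennreal (tail_integral u x \<epsilon>)"
    unfolding tail_integral_def
    by (intro nn_integral_eq_integral tail_integral_small(1) conv e AE_I2 mult_nonneg_nonneg divide_nonneg_nonneg u) auto
  finally show "nn_tail u x \<epsilon> = ennreal (tail_integral u x \<epsilon>)" .
  show "0 \<le> tail_integral u x \<epsilon>"
    unfolding tail_integral_def by (intro integral_nonneg_AE AE_I2 mult_nonneg_nonneg divide_nonneg_nonneg u) auto
qed

lemma norm_diff_sphere_inversion: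
  assumes "x \<noteq> c" "z \<noteq> c" "r > 0"
  shows "norm (x - sphere_inversion c r z) =
    r\<^sup>2 * norm (sphere_inversion c r x - z) / (norm (sphere_inversion c r x - c) * norm (z - c))"
  using norm_sphere_inversion_diff[of "sphere_inversion c r x" c z r] assms
  by (simp add: sphere_inversion_involution sphere_inversion_ne_center)

text \<open>
  An inversion maps a small ball centred at \<open>x\<close> to a ball that contains \<open>x*\<close> but is not centred there. This
  lemma and the next enclose it between two balls centred at \<open>x*\<close>, with radii asymptotic to \<open>\<delta> a\<^sup>2 / r\<^sup>2\<close>; both follow from the
  distance formula and \<open>\<bar>\<bar>z - c\<bar> - a\<bar> \<le> \<bar>x* - z\<bar>\<close>.
\<close>

lemma sphere_inversion_outside_ball:
  fixes c x :: "real ^ 'n"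
  assumes x: "x \<noteq> c" and z: "z \<noteq> c" and r: "r > 0" and d: "\<delta> > 0"
  defines "a \<equiv> norm (sphere_inversion c r x - c)"
  assumes out: "\<delta> \<le> norm (x - sphere_inversion c r z)"
  shows "\<delta> * a\<^sup>2 / (r\<^sup>2 + \<delta> * a) \<le> norm (sphere_inversion c r x - z)" (is "_ \<le> ?t")
proof -
  have a: "a > 0" using sphere_inversion_ne_center[OF r x] by (simp add: a_def)
  have zc: "norm (z - c) > 0" using z by simp
  have "\<delta> * (a * norm (z - c)) \<le> r\<^sup>2 * ?t"
    using out a zc by (simp add: norm_diff_sphere_inversion[OF x z r] a_def[symmetric] pos_le_divide_eq)
  moreover have "a - ?t \<le> norm (z - c)"
    unfolding a_def by norm
  then have "\<delta> * (a * (a - ?t)) \<le> \<delta> * (a * norm (z - c))"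
    using d a by (intro mult_left_mono) auto
  ultimately have "\<delta> * a\<^sup>2 \<le> ?t * (r\<^sup>2 + \<delta> * a)"
    by (simp add: algebra_simps power2_eq_square)
  moreover have "r\<^sup>2 + \<delta> * a > 0" using r d a by (intro add_pos_pos) auto
  ultimately show ?thesis by (simp add: pos_divide_le_eq)
qed

lemma sphere_inversion_inside_ball:
  fixes c x :: "real ^ 'n"
  assumes x: "x \<noteq> c" and z: "z \<noteq> c" and r: "r > 0" and d: "\<delta> > 0"
  defines "a \<equiv> norm (sphere_inversion c r x - c)"
  assumes small: "\<delta> * a < r\<^sup>2"
    and ins: "norm (x - sphere_inversion c r z) < \<delta>"
  shows "norm (sphere_inversion c r x - z) < \<delta> * a\<^sup>2 / (r\<^sup>2 - \<delta> * a)" (is "?t < _")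
proof -
  have a: "a > 0" using sphere_inversion_ne_center[OF r x] by (simp add: a_def)
  have zc: "norm (z - c) > 0" using z by simp
  have "r\<^sup>2 * ?t < \<delta> * (a * norm (z - c))"
    using ins a zc by (simp add: norm_diff_sphere_inversion[OF x z r] a_def[symmetric] pos_divide_less_eq)
  moreover have "norm (z - c) \<le> a + ?t"
    unfolding a_def by norm
  then have "\<delta> * (a * norm (z - c)) \<le> \<delta> * (a * (a + ?t))"
    using d a by (intro mult_left_mono) auto
  ultimately have "?t * (r\<^sup>2 - \<delta> * a) < \<delta> * a\<^sup>2"
    by (simp add: algebra_simps power2_eq_square)
  then show ?thesis using small by (simp add: pos_less_divide_eq)
qed

lemma borel_measurable_kelvin_transform [measurable]:
  assumes [measurable]: "u \<in> borel_measurable borel"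
  shows "kelvin_transform c r u \<in> borel_measurable borel"
  unfolding kelvin_transform_def[abs_def] by measurable

lemma kelvin_transform_nonneg: "(\<And>y. 0 \<le> u y) \<Longrightarrow> r > 0 \<Longrightarrow> 0 \<le> kelvin_transform c r u x"
  unfolding kelvin_transform_def by (intro mult_nonneg_nonneg zero_le_power divide_nonneg_nonneg) auto

lemma nn_tail_kelvin:
  fixes u :: "real ^ 'n \<Rightarrow> real"
  assumes [measurable]: "u \<in> borel_measurable borel" and u: "\<And>y. 0 \<le> u y" and r: "r > 0" and x: "x \<noteq> c"
  shows "nn_tail (kelvin_transform c r u) x \<delta> = ennreal ((r / norm (x - c)) ^ CARD('n)) *
    (\<integral>\<^sup>+z. ennreal (u z) * indicator (- ball x \<delta>) (sphere_inversion c r z) * ennreal (1 / norm (sphere_inversion c r x - z) ^ CARD('n)) \<partial>lborel)"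
proof -
  have [measurable]: "ball x \<delta> \<in> sets borel" by simp
  have "nn_tail (kelvin_transform c r u) x \<delta> =
    (\<integral>\<^sup>+y. ennreal ((r / norm (y - c)) ^ CARD('n)) *
       (ennreal (u (sphere_inversion c r y)) * indicator (- ball x \<delta>) (sphere_inversion c r (sphere_inversion c r y)))
       * ennreal (1 / norm (x - y) ^ CARD('n)) \<partial>lborel)"
    unfolding nn_tail_def
  proof (rule nn_integral_cong_AE, use AE_lborel_singleton[of c] in eventually_elim)
    case (elim y)
    then show ?case using r u
      by (simp add: kelvin_transform_def sphere_inversion_involution ennreal_mult mult_ac)
  qed
  also have "\<dots> = ennreal ((r / norm (x - c)) ^ CARD('n)) *
    (\<integral>\<^sup>+z. (ennreal (u z) * indicator (- ball x \<delta>) (sphere_inversion c r z)) * ennreal (1 / norm (sphere_inversion c r x - z) ^ CARD('n)) \<partial>lborel)"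
    by (rule nn_integral_kelvin_kernel) (use r x in measurable)
  finally show ?thesis .
qed

text \<open>
  As \<open>u\<close> is nonnegative, the enclosure of the inverted ball between two balls yields bounds for the tail of
  the Kelvin transform by tails of \<open>u\<close>.
\<close>

lemma nn_tail_kelvin_bounds:
  fixes u :: "real ^ 'n \<Rightarrow> real"
  assumes [measurable]: "u \<in> borel_measurable borel" and u: "\<And>y. 0 \<le> u y" and r: "r > 0" and x: "x \<noteq> c" and d: "\<delta> > 0"
  defines "q \<equiv> sphere_inversion c r x"
  defines "a \<equiv> norm (q - c)"
  shows "nn_tail (kelvin_transform c r u) x \<delta> \<le> ennreal ((r / norm (x - c)) ^ CARD('n)) * nn_tail u q (\<delta> * a\<^sup>2 / (r\<^sup>2 + \<delta> * a))"
    and "\<delta> * a < r\<^sup>2 \<Longrightarrow> ennreal ((r / norm (x - c)) ^ CARD('n)) * nn_tail u q (\<delta> * a\<^sup>2 / (r\<^sup>2 - \<delta> * a)) \<le> nn_tail (kelvin_transform c r u) x \<delta>"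
proof -
  note eq = nn_tail_kelvin[OF assms(1) u r x, of \<delta>, folded q_def]
  have ne: "AE z in lborel. z \<noteq> c" by (rule AE_lborel_singleton)
  show "nn_tail (kelvin_transform c r u) x \<delta> \<le> ennreal ((r / norm (x - c)) ^ CARD('n)) * nn_tail u q (\<delta> * a\<^sup>2 / (r\<^sup>2 + \<delta> * a))"
    unfolding eq nn_tail_def[of u]
  proof (intro mult_left_mono nn_integral_mono_AE, use ne in eventually_elim)
    case (elim z)
    show ?case
      using sphere_inversion_outside_ball[OF x elim r d]
      by (auto simp: q_def a_def dist_norm not_less split: split_indicator)
  qed auto
  show "ennreal ((r / norm (x - c)) ^ CARD('n)) * nn_tail u q (\<delta> * a\<^sup>2 / (r\<^sup>2 - \<delta> * a)) \<le> nn_tail (kelvin_transform c r u) x \<delta>"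
    if small: "\<delta> * a < r\<^sup>2"
    unfolding eq nn_tail_def[of u]
  proof (intro mult_left_mono nn_integral_mono_AE, use ne in eventually_elim)
    case (elim z)
    show ?case
      using sphere_inversion_inside_ball[OF x elim r d] small
      by (auto simp: q_def a_def dist_norm not_less split: split_indicator)
  qed auto
qed

lemma abs_power_diff_one_le:
  fixes p :: real
  assumes "0 \<le> p" "p \<le> 2"
  shows "\<bar>p ^ n - 1\<bar> \<le> real n * 2 ^ n * \<bar>p - 1\<bar>"
proof (induction n)
  case (Suc n)
  have "\<bar>p ^ Suc n - 1\<bar> = \<bar>p * (p ^ n - 1) + (p - 1)\<bar>" by (simp add: algebra_simps)
  also have "\<dots> \<le> p * \<bar>p ^ n - 1\<bar> + \<bar>p - 1\<bar>"
    using assms abs_triangle_ineq[of "p * (p ^ n - 1)" "p - 1"] by (simp add: abs_mult)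
  also have "p * \<bar>p ^ n - 1\<bar> \<le> 2 * (real n * 2 ^ n * \<bar>p - 1\<bar>)"
    using assms Suc by (intro mult_mono) auto
  finally have "\<bar>p ^ Suc n - 1\<bar> \<le> 2 * (real n * 2 ^ n * \<bar>p - 1\<bar>) + \<bar>p - 1\<bar>" by simp
  moreover have "1 * \<bar>p - 1\<bar> \<le> 2 ^ Suc n * \<bar>p - 1\<bar>"
    by (intro mult_right_mono one_le_power) auto
  ultimately show ?case by (simp add: algebra_simps)
qed simp

lemma nn_integral_norm_kernel_ball:
  fixes q :: "real ^ 'n"
  shows "(\<integral>\<^sup>+z. ennreal (norm (q - z)) * ennreal (1 / norm (q - z) ^ CARD('n)) * indicator (ball q 1) z \<partial>lborel) < \<infinity>"
proof -
  let ?g = "\<lambda>t::real. ennreal t * ennreal (1 / t ^ CARD('n)) * indicator {..<1} t"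
  have "(\<integral>\<^sup>+z. ennreal (norm (q - z)) * ennreal (1 / norm (q - z) ^ CARD('n)) * indicator (ball q 1) z \<partial>lborel)
     = (\<integral>\<^sup>+z. ?g (norm (q - z)) \<partial>lborel)"
    by (intro nn_integral_cong) (auto simp: dist_norm split: split_indicator)
  also have "\<dots> = ennreal (sphere_area CARD('n)) * (\<integral>\<^sup>+t. ?g t * ennreal (t ^ (CARD('n) - 1)) * indicator {0..} t \<partial>lborel)"
    by (rule nn_integral_radial_about) measurable
  also have "(\<integral>\<^sup>+t. ?g t * ennreal (t ^ (CARD('n) - 1)) * indicator {0..} t \<partial>lborel) \<le> (\<integral>\<^sup>+t. indicator {0..1::real} t \<partial>lborel)"
  proof (rule nn_integral_mono)
    fix t :: real
    have "t * (1 / t ^ CARD('n)) * t ^ (CARD('n) - 1) = 1" if "t > 0"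
      unfolding mult.assoc using that by (subst power_kernel_mult) simp_all
    then show "?g t * ennreal (t ^ (CARD('n) - 1)) * indicator {0..} t \<le> indicator {0..1} t"
      by (cases "t = 0") (auto split: split_indicator simp flip: ennreal_mult)
  qed
  also have "\<dots> = 1" by simp
  finally have "(\<integral>\<^sup>+z. ennreal (norm (q - z)) * ennreal (1 / norm (q - z) ^ CARD('n)) * indicator (ball q 1) z \<partial>lborel) \<le> ennreal (sphere_area CARD('n)) * 1"
    by (simp add: mult_left_mono)
  also have "\<dots> < \<infinity>" by simp
  finally show ?thesis .
qed

lemma converges_near_finite:
  fixes u :: "real ^ 'n \<Rightarrow> real"
  assumes [measurable]: "u \<in> borel_measurable borel" and conv: "log_laplacian_converges u q"
  shows "(\<integral>\<^sup>+z. ennreal \<bar>u q - u z\<bar> * ennreal (1 / norm (q - z) ^ CARD('n)) * indicator (ball q 1) z \<partial>lborel) < \<infinity>"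
proof -
  have "(\<integral>\<^sup>+z. ennreal \<bar>u q - u z\<bar> * ennreal (1 / norm (q - z) ^ CARD('n)) * indicator (ball q 1) z \<partial>lborel)
     \<le> (\<integral>\<^sup>+z. ennreal (norm (log_laplacian_integrand u q z)) \<partial>lborel)"
    by (intro nn_integral_mono)
      (auto simp: log_laplacian_integrand_def abs_divide split: split_indicator simp flip: ennreal_mult)
  also have "\<dots> < \<infinity>"
    using conv by (simp add: log_laplacian_converges_iff integrable_iff_bounded)
  finally show ?thesis .
qed

text \<open>
  Pulled back by the inversion, the difference \<open>v x - v y\<close> for \<open>v\<close> the Kelvin transform becomes
  \<open>u q (a / \<bar>z - c\<bar>) ^ n - u z\<close>, where \<open>q = x*\<close> and \<open>a = \<bar>q - c\<bar>\<close>. It differs from \<open>u q - u z\<close> by an error that is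
  Lipschitz in \<open>z\<close> near \<open>q\<close> and vanishes at \<open>q\<close>, so its product with the kernel is integrable.
\<close>

lemma kelvin_transform_converges:
  fixes u :: "real ^ 'n \<Rightarrow> real"
  assumes [measurable]: "u \<in> borel_measurable borel" and u: "\<And>y. 0 \<le> u y" and r: "r > 0" and x: "x \<noteq> c"
    and conv: "log_laplacian_converges u (sphere_inversion c r x)"
  shows "log_laplacian_converges (kelvin_transform c r u) x"
proof -
  let ?inv = "sphere_inversion c r" and ?v = "kelvin_transform c r u"
  define q where "q = ?inv x"
  define a where "a = norm (q - c)"
  define \<kappa> where "\<kappa> = (r / norm (x - c)) ^ CARD('n)"
  have a: "a > 0" using sphere_inversion_ne_center[OF r x] by (simp add: a_def q_def)
  have \<kappa>: "\<kappa> \<ge> 0" using r by (simp add: \<kappa>_def)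
  have a_eq: "a = r\<^sup>2 / norm (x - c)" by (simp add: a_def q_def norm_sphere_inversion_center)
  define \<rho> where "\<rho> = min 1 (a / 2)"
  \<comment> \<open>With this \<open>d\<close> the inversion maps \<open>ball x d - {c}\<close> into \<open>ball q \<rho>\<close>, where \<open>\<bar>z - c\<bar> \<ge> a / 2\<close>.\<close>
  define d where "d = min 1 (r\<^sup>2 * \<rho> / (a * (a + \<rho>)))"
  have \<rho>: "0 < \<rho>" "\<rho> \<le> 1" "\<rho> \<le> a / 2" using a by (auto simp: \<rho>_def)
  have d: "0 < d" "d \<le> 1" using a \<rho> r by (auto simp: d_def)
  have da: "d * (a * (a + \<rho>)) \<le> r\<^sup>2 * \<rho>"
  proof -
    have "d \<le> r\<^sup>2 * \<rho> / (a * (a + \<rho>))" by (simp add: d_def)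
    then show ?thesis using a \<rho> by (simp add: pos_le_divide_eq)
  qed
  have d_a: "d * a < r\<^sup>2"
  proof -
    have "d * a * \<rho> < d * (a * (a + \<rho>))" using a d \<rho> by (simp add: algebra_simps)
    also note da
    finally show ?thesis using \<rho> by simp
  qed
  have e_le: "d * a\<^sup>2 / (r\<^sup>2 - d * a) \<le> \<rho>"
    using d_a da by (simp add: pos_divide_le_eq algebra_simps power2_eq_square)
  have [measurable]: "ball x d \<in> sets borel" "ball q 1 \<in> sets borel" by simp_all
  define M where "M = real CARD('n) * 2 ^ CARD('n) * (2 / a)"
  have M: "M \<ge> 0" using a by (simp add: M_def)
  let ?\<phi> = "\<lambda>z. ennreal \<bar>u q * (a / norm (z - c)) ^ CARD('n) - u z\<bar> * indicator (ball x d) (?inv z)"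
  show ?thesis
  proof (rule log_laplacian_convergesI[OF _ d])
    have "(\<integral>\<^sup>+y. ennreal \<bar>?v x - ?v y\<bar> * ennreal (1 / norm (x - y) ^ CARD('n)) * indicator (ball x d) y \<partial>lborel)
      = (\<integral>\<^sup>+y. ennreal ((r / norm (y - c)) ^ CARD('n)) * ?\<phi> (?inv y) * ennreal (1 / norm (x - y) ^ CARD('n)) \<partial>lborel)"
    proof (rule nn_integral_cong_AE, use AE_lborel_singleton[of c] in eventually_elim)
      case (elim y)
      have "r / norm (x - c) = (r / norm (y - c)) * (a / norm (?inv y - c))"
        using r elim x by (simp add: a_eq norm_sphere_inversion_center field_simps power2_eq_square)
      then have "\<kappa> = (r / norm (y - c)) ^ CARD('n) * (a / norm (?inv y - c)) ^ CARD('n)"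
        by (simp add: \<kappa>_def flip: power_mult_distrib)
      then have "?v x - ?v y = (r / norm (y - c)) ^ CARD('n) * (u q * (a / norm (?inv y - c)) ^ CARD('n) - u (?inv y))"
        by (simp add: kelvin_transform_def q_def[symmetric] \<kappa>_def[symmetric] algebra_simps)
      then have "\<bar>?v x - ?v y\<bar> = (r / norm (y - c)) ^ CARD('n) * \<bar>u q * (a / norm (?inv y - c)) ^ CARD('n) - u (?inv y)\<bar>"
        using r by (simp add: abs_mult)
      moreover have "?inv (?inv y) = y" using elim r by (rule sphere_inversion_involution)
      ultimately show ?case using r by (simp add: ennreal_mult mult_ac)
    qed
    also have "\<dots> = ennreal \<kappa> * (\<integral>\<^sup>+z. ?\<phi> z * ennreal (1 / norm (q - z) ^ CARD('n)) \<partial>lborel)"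
      unfolding \<kappa>_def q_def[symmetric] using nn_integral_kelvin_kernel[of ?\<phi> r x c] r x by (simp add: q_def)
    finally have pulled_back: "(\<integral>\<^sup>+y. ennreal \<bar>?v x - ?v y\<bar> * ennreal (1 / norm (x - y) ^ CARD('n)) * indicator (ball x d) y \<partial>lborel)
      = ennreal \<kappa> * (\<integral>\<^sup>+z. ?\<phi> z * ennreal (1 / norm (q - z) ^ CARD('n)) \<partial>lborel)" .
    have "(\<integral>\<^sup>+z. ?\<phi> z * ennreal (1 / norm (q - z) ^ CARD('n)) \<partial>lborel) \<le>
      (\<integral>\<^sup>+z. ennreal \<bar>u q - u z\<bar> * ennreal (1 / norm (q - z) ^ CARD('n)) * indicator (ball q 1) z
         + ennreal (u q * M) * (ennreal (norm (q - z)) * ennreal (1 / norm (q - z) ^ CARD('n)) * indicator (ball q 1) z) \<partial>lborel)"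
    proof (rule nn_integral_mono_AE, use AE_lborel_singleton[of c] in eventually_elim)
      case (elim z)
      show ?case
      proof (cases "?inv z \<in> ball x d")
        case True
        let ?t = "norm (q - z)" and ?p = "a / norm (z - c)"
        have t: "?t < \<rho>"
          using sphere_inversion_inside_ball[OF x elim r d(1)] d_a e_le True
          by (simp add: q_def a_def dist_norm)
        have zc: "a / 2 \<le> norm (z - c)"
        proof -
          have "a \<le> ?t + norm (z - c)" unfolding a_def by norm
          then show ?thesis using t \<rho> by simp
        qed
        then have zc0: "norm (z - c) > 0" using a by linarith
        have "\<bar>?p - 1\<bar> = \<bar>a - norm (z - c)\<bar> / norm (z - c)"
          using zc0 by (simp add: field_simps)
        also have "\<dots> \<le> ?t / (a / 2)"
        proof (intro frac_le)
          have "a \<le> ?t + norm (z - c)" "norm (z - c) \<le> a + ?t" unfolding a_def by norm+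
          then show "\<bar>a - norm (z - c)\<bar> \<le> ?t" by simp
        qed (use a zc in auto)
        finally have p1: "\<bar>?p - 1\<bar> \<le> 2 / a * ?t" by (simp add: mult.commute)
        have "?p \<le> 2" using zc zc0 by (simp add: pos_divide_le_eq)
        then have "\<bar>?p ^ CARD('n) - 1\<bar> \<le> real CARD('n) * 2 ^ CARD('n) * \<bar>?p - 1\<bar>"
          using a by (intro abs_power_diff_one_le) auto
        also have "\<dots> \<le> real CARD('n) * 2 ^ CARD('n) * (2 / a * ?t)"
          by (intro mult_left_mono p1) auto
        finally have pn: "\<bar>?p ^ CARD('n) - 1\<bar> \<le> M * ?t" by (simp add: M_def)
        have "\<bar>u q * ?p ^ CARD('n) - u z\<bar> = \<bar>(u q - u z) + u q * (?p ^ CARD('n) - 1)\<bar>"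
          by (simp add: algebra_simps)
        also have "\<dots> \<le> \<bar>u q - u z\<bar> + u q * \<bar>?p ^ CARD('n) - 1\<bar>"
          using u[of q] abs_triangle_ineq[of "u q - u z" "u q * (?p ^ CARD('n) - 1)"] by (simp add: abs_mult)
        also have "\<dots> \<le> \<bar>u q - u z\<bar> + u q * (M * ?t)"
          by (intro add_left_mono mult_left_mono pn u)
        finally have "\<bar>u q * ?p ^ CARD('n) - u z\<bar> * (1 / ?t ^ CARD('n)) \<le> (\<bar>u q - u z\<bar> + u q * (M * ?t)) * (1 / ?t ^ CARD('n))"
          by (intro mult_right_mono) auto
        also have "\<dots> = \<bar>u q - u z\<bar> * (1 / ?t ^ CARD('n)) + u q * M * (?t * (1 / ?t ^ CARD('n)))"
          by (simp only: distrib_right mult.assoc)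
        finally have "ennreal \<bar>u q * ?p ^ CARD('n) - u z\<bar> * ennreal (1 / ?t ^ CARD('n)) \<le>
           ennreal \<bar>u q - u z\<bar> * ennreal (1 / ?t ^ CARD('n)) + ennreal (u q * M) * (ennreal ?t * ennreal (1 / ?t ^ CARD('n)))"
          using M u[of q] by (simp del: ennreal_plus add: ennreal_plus[symmetric] flip: ennreal_mult)
        moreover have "z \<in> ball q 1" using t \<rho> by (simp add: dist_norm)
        ultimately show ?thesis using True by simp
      qed simp
    qed
    also have "\<dots> = (\<integral>\<^sup>+z. ennreal \<bar>u q - u z\<bar> * ennreal (1 / norm (q - z) ^ CARD('n)) * indicator (ball q 1) z \<partial>lborel)
         + ennreal (u q * M) * (\<integral>\<^sup>+z. ennreal (norm (q - z)) * ennreal (1 / norm (q - z) ^ CARD('n)) * indicator (ball q 1) z \<partial>lborel)"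
      by (subst nn_integral_add, measurable, subst nn_integral_cmult, measurable)
    also have "\<dots> < \<infinity>"
      using converges_near_finite[of u q] conv nn_integral_norm_kernel_ball[of q]
      by (simp add: ennreal_mult_less_top q_def)
    finally have "(\<integral>\<^sup>+z. ?\<phi> z * ennreal (1 / norm (q - z) ^ CARD('n)) \<partial>lborel) < \<infinity>" .
    then show "(\<integral>\<^sup>+y. ennreal \<bar>?v x - ?v y\<bar> * ennreal (1 / norm (x - y) ^ CARD('n)) * indicator (ball x d) y \<partial>lborel) < \<infinity>"
      unfolding pulled_back by (simp add: ennreal_mult_less_top)
  next
    let ?e = "d * a\<^sup>2 / (r\<^sup>2 + d * a)"
    have e: "0 < ?e" "?e \<le> 1"
    proof -
      show "0 < ?e" using a d r by (intro divide_pos_pos add_pos_pos mult_pos_pos) auto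
      have "?e \<le> d * a\<^sup>2 / (r\<^sup>2 - d * a)"
        using a d d_a r by (intro divide_left_mono mult_pos_pos) (auto simp: add_pos_pos)
      then show "?e \<le> 1" using e_le \<rho> by simp
    qed
    have "(\<integral>\<^sup>+y. ennreal \<bar>?v y\<bar> * ennreal (1 / norm (x - y) ^ CARD('n)) * indicator (- ball x d) y \<partial>lborel) = nn_tail ?v x d"
      unfolding nn_tail_def by (simp add: kelvin_transform_nonneg u r)
    also have "\<dots> \<le> ennreal \<kappa> * nn_tail u q ?e"
      using nn_tail_kelvin_bounds(1)[OF assms(1) u r x d(1)] by (simp add: q_def a_def \<kappa>_def)
    also have "nn_tail u q ?e = ennreal (tail_integral u q ?e)"
      using conv e u by (intro nn_tail_eq_tail_integral) (auto simp: q_def)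
    also have "ennreal \<kappa> * \<dots> < \<infinity>" by (simp add: ennreal_mult_less_top)
    finally show "(\<integral>\<^sup>+y. ennreal \<bar>?v y\<bar> * ennreal (1 / norm (x - y) ^ CARD('n)) * indicator (- ball x d) y \<partial>lborel) < \<infinity>" .
  qed measurable
qed

text \<open>
  Near \<open>x\<close> the inversion scales lengths by \<open>a\<^sup>2 / r\<^sup>2 = (r / \<bar>x - c\<bar>)\<^sup>2\<close> up to a factor tending to \<open>1\<close>. The renormalised
  tails of the Kelvin transform are therefore squeezed between those of \<open>u\<close> at two cutoffs, both of which
  shift the logarithm by \<open>ln (a\<^sup>2 / r\<^sup>2)\<close> in the limit.
\<close>

lemma log_laplacian_kelvin:
  fixes u :: "real ^ 'n \<Rightarrow> real"
  assumes m [measurable]: "u \<in> borel_measurable borel" and u: "\<And>y. 0 \<le> u y" and r: "r > 0" and x: "x \<noteq> c"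
    and conv: "log_laplacian_converges u (sphere_inversion c r x)"
  shows "log_laplacian (kelvin_transform c r u) x = (r / norm (x - c)) ^ CARD('n) *
    (log_laplacian u (sphere_inversion c r x) + 4 * ln (r / norm (x - c)) * u (sphere_inversion c r x))"
proof -
  let ?v = "kelvin_transform c r u" and ?\<omega> = "sphere_area CARD('n)"
  define q where "q = sphere_inversion c r x"
  define a where "a = norm (q - c)"
  define \<kappa> where "\<kappa> = (r / norm (x - c)) ^ CARD('n)"
  \<comment> \<open>The radii of the two enclosing balls; their quotients by \<open>\<delta>\<close> tend to \<open>a\<^sup>2 / r\<^sup>2\<close>.\<close>
  define ep where "ep = (\<lambda>\<delta>. \<delta> * a\<^sup>2 / (r\<^sup>2 - \<delta> * a))"
  define em where "em = (\<lambda>\<delta>. \<delta> * a\<^sup>2 / (r\<^sup>2 + \<delta> * a))"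
  have conv_q: "log_laplacian_converges u q" using conv by (simp add: q_def)
  have conv_v: "log_laplacian_converges ?v x" by (rule kelvin_transform_converges) (use assms in auto)
  have a: "a > 0" using sphere_inversion_ne_center[OF r x] by (simp add: a_def q_def)
  have \<kappa>: "\<kappa> \<ge> 0" using r by (simp add: \<kappa>_def)
  have a_r: "a / r = r / norm (x - c)"
    using r by (simp add: a_def q_def norm_sphere_inversion_center power2_eq_square)
  have v_x: "?v x = \<kappa> * u q" by (simp add: kelvin_transform_def \<kappa>_def q_def)
  let ?G = "\<lambda>\<epsilon>. u q * (?\<omega> * ln (1 / \<epsilon>)) - tail_integral u q \<epsilon>"
  let ?F = "\<lambda>\<epsilon>. ?v x * (?\<omega> * ln (1 / \<epsilon>)) - tail_integral ?v x \<epsilon>"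
  let ?I = "LINT y|lebesgue. log_laplacian_integrand u q y"
  let ?L = "\<kappa> * (?I + u q * (?\<omega> * ln (a\<^sup>2 / r\<^sup>2)))"
  have G: "(?G \<longlongrightarrow> ?I) (at_right 0)" by (rule log_laplacian_as_limit[OF m conv_q])
  have ev_small: "\<forall>\<^sub>F \<delta> in at_right 0. 0 < \<delta> \<and> \<delta> < 1 \<and> \<delta> * a < r\<^sup>2"
  proof -
    have "((\<lambda>\<delta>. \<delta> * a) \<longlongrightarrow> 0) (at_right 0)" by (auto intro!: tendsto_eq_intros)
    then have "\<forall>\<^sub>F \<delta> in at_right 0. \<delta> * a < r\<^sup>2" using r by (intro order_tendstoD) auto
    moreover have "\<forall>\<^sub>F \<delta>::real in at_right 0. \<delta> \<in> {0<..<1}" by (rule eventually_at_right_real) simp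
    ultimately show ?thesis by eventually_elim auto
  qed
  have lim_ep: "(ep \<longlongrightarrow> 0) (at_right 0)" and lim_em: "(em \<longlongrightarrow> 0) (at_right 0)"
    unfolding ep_def em_def using r by (auto intro!: tendsto_eq_intros)
  have ev_pos: "\<forall>\<^sub>F \<delta> in at_right 0. 0 < ep \<delta> \<and> 0 < em \<delta>"
    using ev_small by eventually_elim (use a r in \<open>auto simp: ep_def em_def intro!: divide_pos_pos add_pos_pos\<close>)
  have fl: "filterlim ep (at_right 0) (at_right 0)" "filterlim em (at_right 0) (at_right 0)"
    unfolding filterlim_at using lim_ep lim_em ev_pos by (auto elim: eventually_mono)
  have ln_quot: "((\<lambda>\<delta>. ln (a\<^sup>2 / (r\<^sup>2 - \<delta> * a))) \<longlongrightarrow> ln (a\<^sup>2 / r\<^sup>2)) (at_right 0)"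
    "((\<lambda>\<delta>. ln (a\<^sup>2 / (r\<^sup>2 + \<delta> * a))) \<longlongrightarrow> ln (a\<^sup>2 / r\<^sup>2)) (at_right 0)"
    using a r by (auto intro!: tendsto_eq_intros)
  have lim_upper: "((\<lambda>\<delta>. \<kappa> * (?G (ep \<delta>) + u q * (?\<omega> * ln (a\<^sup>2 / (r\<^sup>2 - \<delta> * a))))) \<longlongrightarrow> ?L) (at_right 0)"
    by (intro tendsto_intros filterlim_compose[OF G] fl ln_quot)
  have lim_lower: "((\<lambda>\<delta>. \<kappa> * (?G (em \<delta>) + u q * (?\<omega> * ln (a\<^sup>2 / (r\<^sup>2 + \<delta> * a))))) \<longlongrightarrow> ?L) (at_right 0)"
    by (intro tendsto_intros filterlim_compose[OF G] fl ln_quot)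
  have ev_le1: "\<forall>\<^sub>F \<delta> in at_right 0. ep \<delta> < 1 \<and> em \<delta> < 1"
    using order_tendstoD(2)[OF lim_ep, of 1] order_tendstoD(2)[OF lim_em, of 1] by (simp add: eventually_conj)
  have "\<forall>\<^sub>F \<delta> in at_right 0. \<kappa> * (?G (em \<delta>) + u q * (?\<omega> * ln (a\<^sup>2 / (r\<^sup>2 + \<delta> * a)))) \<le> ?F \<delta> \<and>
     ?F \<delta> \<le> \<kappa> * (?G (ep \<delta>) + u q * (?\<omega> * ln (a\<^sup>2 / (r\<^sup>2 - \<delta> * a))))"
    using ev_small ev_pos ev_le1
  proof eventually_elim
    case (elim \<delta>)
    then have \<delta>: "0 < \<delta>" "\<delta> < 1" "\<delta> * a < r\<^sup>2" "0 < ep \<delta>" "0 < em \<delta>" "ep \<delta> < 1" "em \<delta> < 1" by auto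
    note tails = nn_tail_eq_tail_integral[OF m u conv_q]
    have tail_v: "nn_tail ?v x \<delta> = ennreal (tail_integral ?v x \<delta>)" "0 \<le> tail_integral ?v x \<delta>"
      using \<delta> by (auto intro!: nn_tail_eq_tail_integral conv_v kelvin_transform_nonneg u r)
    have "ennreal (tail_integral ?v x \<delta>) \<le> ennreal (\<kappa> * tail_integral u q (em \<delta>))"
    proof -
      have "nn_tail ?v x \<delta> \<le> ennreal \<kappa> * nn_tail u q (em \<delta>)"
        using nn_tail_kelvin_bounds(1)[OF m u r x \<delta>(1)] unfolding q_def a_def \<kappa>_def em_def .
      then show ?thesis using \<delta> tails[of "em \<delta>"] \<kappa> by (simp add: tail_v ennreal_mult)
    qed
    then have up: "tail_integral ?v x \<delta> \<le> \<kappa> * tail_integral u q (em \<delta>)"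
      using \<kappa> tails(2)[of "em \<delta>"] \<delta> by (simp add: ennreal_le_iff)
    have "ennreal (\<kappa> * tail_integral u q (ep \<delta>)) \<le> ennreal (tail_integral ?v x \<delta>)"
    proof -
      have "ennreal \<kappa> * nn_tail u q (ep \<delta>) \<le> nn_tail ?v x \<delta>"
        using nn_tail_kelvin_bounds(2)[OF m u r x \<delta>(1)] \<delta>(3) unfolding q_def a_def \<kappa>_def ep_def .
      then show ?thesis using \<delta> tails[of "ep \<delta>"] \<kappa> by (simp add: tail_v ennreal_mult)
    qed
    then have low: "\<kappa> * tail_integral u q (ep \<delta>) \<le> tail_integral ?v x \<delta>"
      using tail_v by (simp add: ennreal_le_iff)
    have lnp: "ln (1 / ep \<delta>) + ln (a\<^sup>2 / (r\<^sup>2 - \<delta> * a)) = ln (1 / \<delta>)"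
      using \<delta> a by (simp add: ep_def ln_div ln_mult)
    have "r\<^sup>2 + \<delta> * a > 0" using \<delta> a r by (intro add_pos_pos) auto
    then have lnm: "ln (1 / em \<delta>) + ln (a\<^sup>2 / (r\<^sup>2 + \<delta> * a)) = ln (1 / \<delta>)"
      using \<delta> a by (simp add: em_def ln_div ln_mult)
    have "\<kappa> * (?G (em \<delta>) + u q * (?\<omega> * ln (a\<^sup>2 / (r\<^sup>2 + \<delta> * a)))) = ?v x * (?\<omega> * ln (1 / \<delta>)) - \<kappa> * tail_integral u q (em \<delta>)"
      unfolding lnm[symmetric] v_x by (simp add: algebra_simps)
    moreover have "\<kappa> * (?G (ep \<delta>) + u q * (?\<omega> * ln (a\<^sup>2 / (r\<^sup>2 - \<delta> * a)))) = ?v x * (?\<omega> * ln (1 / \<delta>)) - \<kappa> * tail_integral u q (ep \<delta>)"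
      unfolding lnp[symmetric] v_x by (simp add: algebra_simps)
    ultimately show ?case using up low by simp
  qed
  then have "(?F \<longlongrightarrow> ?L) (at_right 0)"
    by (intro tendsto_sandwich[OF _ _ lim_lower lim_upper]) (auto elim: eventually_mono)
  moreover have "(?F \<longlongrightarrow> (LINT y|lebesgue. log_laplacian_integrand ?v x y)) (at_right 0)"
    by (rule log_laplacian_as_limit[OF _ conv_v]) measurable
  ultimately have eq: "(LINT y|lebesgue. log_laplacian_integrand ?v x y) = ?L"
    by (intro tendsto_unique[OF _ _ _, rotated]) auto
  have "ln (a\<^sup>2 / r\<^sup>2) = 2 * ln (r / norm (x - c))"
    using a r by (simp add: power_divide[symmetric] a_r[symmetric] ln_realpow)
  moreover have "log_laplacian ?v x = \<kappa> * (log_laplacian u q + c_const CARD('n) * ?\<omega> * ln (a\<^sup>2 / r\<^sup>2) * u q)"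
    unfolding log_laplacian_def eq v_x by (simp add: algebra_simps)
  ultimately show ?thesis by (simp add: c_const_sphere_area \<kappa>_def q_def)
qed

text \<open>
  The correction \<open>4 ln (r / \<bar>x - c\<bar>)\<close> equals \<open>4 / n\<close> times the logarithm of the Kelvin weight, so it is absorbed by
  the nonlinearity \<open>4 / n * v ln v\<close>. This is where the coefficient \<open>4 / n\<close> is essential.
\<close>

lemma kelvin_transform_satisfies_log_eq:
  fixes u :: "real ^ 'n \<Rightarrow> real"
  assumes m: "u \<in> borel_measurable borel" and u: "\<And>y. 0 \<le> u y" and r: "r > 0" and x: "x \<noteq> c"
    and conv: "log_laplacian_converges u (sphere_inversion c r x)"
    and eq: "satisfies_log_eq_at T u (sphere_inversion c r x)"
  shows "satisfies_log_eq_at T (kelvin_transform c r u) x"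
proof -
  let ?q = "sphere_inversion c r x"
  define \<kappa> where "\<kappa> = (r / norm (x - c)) ^ CARD('n)"
  define b where "b = 4 / real CARD('n)"
  define w where "w = ln (r / norm (x - c))"
  have \<kappa>: "\<kappa> > 0" using r x by (simp add: \<kappa>_def)
  have v_x: "kelvin_transform c r u x = \<kappa> * u ?q" by (simp add: kelvin_transform_def \<kappa>_def)
  have ln_\<kappa>: "b * ln \<kappa> = 4 * w"
    using r x by (simp add: \<kappa>_def b_def w_def ln_realpow)
  have Lu: "log_laplacian u ?q = b * (u ?q * ln (u ?q)) - T * u ?q"
    using eq by (simp add: satisfies_log_eq_at_def b_def)
  have Lv: "log_laplacian (kelvin_transform c r u) x = \<kappa> * (log_laplacian u ?q + b * ln \<kappa> * u ?q)"
    unfolding ln_\<kappa> using log_laplacian_kelvin[OF m u r x conv] by (simp add: \<kappa>_def w_def)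
  have ln_v: "\<kappa> * u ?q * ln (\<kappa> * u ?q) = \<kappa> * u ?q * (ln \<kappa> + ln (u ?q))"
    using u[of ?q] \<kappa> by (cases "u ?q = 0") (auto simp: ln_mult)
  show ?thesis
    unfolding satisfies_log_eq_at_def b_def[symmetric] v_x Lv Lu ln_v by (simp add: algebra_simps)
qed

section \<open>The symmetries of the equation\<close>

theorem proposition1p1:
  fixes T :: real and u :: "real ^ 'n \<Rightarrow> real"
  assumes "log_eq_solution T u"
  shows
    "(\<forall>l>0. \<forall>x\<^sub>0. log_eq_solution (T + 4 / real CARD('n) * ln l) (\<lambda>x. l * u (x + x\<^sub>0)))
     \<and> (\<forall>l>0.
          log_eq_solution T (\<lambda>x. l powr (- (real CARD('n) / 2)) * u (inverse l *\<^sub>R x))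
          \<and> (u \<in> L2_space \<longrightarrow>
               (\<lambda>x. l powr (- (real CARD('n) / 2)) * u (inverse l *\<^sub>R x)) \<in> L2_space
               \<and> L2_norm (\<lambda>x. l powr (- (real CARD('n) / 2)) * u (inverse l *\<^sub>R x)) = L2_norm u))
     \<and> (\<forall>c. \<forall>r>0. \<forall>x. x \<noteq> c \<longrightarrow>
          log_laplacian_converges (kelvin_transform c r u) x
          \<and> satisfies_log_eq_at T (kelvin_transform c r u) x)"
proof -
  have u: "u \<in> dini_space" "u \<in> L10_space" "\<And>x. 0 \<le> u x" "\<And>x. satisfies_log_eq_at T u x"
    using assms by (auto simp: log_eq_solution_def)
  have m: "u \<in> borel_measurable borel" using u(1) by (rule dini_space_imp_borel)
  have conv: "log_laplacian_converges u x" for x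
    using u m by (intro dini_L10_converges) (auto simp: dini_space_def)
  show ?thesis
  proof (intro conjI allI impI)
    fix l :: real assume l: "l > 0"
    show "log_eq_solution (T + 4 / real CARD('n) * ln l) (\<lambda>x. l * u (x + x\<^sub>0))" for x\<^sub>0
      using log_eq_solution_affine[OF assms l zero_less_one, of x\<^sub>0] by simp
    have "4 / real CARD('n) * ln (l powr (- (real CARD('n) / 2))) - 2 * ln (inverse l) = 0"
      using l by (simp add: ln_powr ln_inverse)
    then have T: "T + 4 / real CARD('n) * ln (l powr (- (real CARD('n) / 2))) - 2 * ln (inverse l) = T"
      by linarith
    show "log_eq_solution T (\<lambda>x. l powr (- (real CARD('n) / 2)) * u (inverse l *\<^sub>R x))"
      using log_eq_solution_affine[OF assms, of "l powr (- (real CARD('n) / 2))" "inverse l" 0] l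
      unfolding T by simp
    show "(\<lambda>x. l powr (- (real CARD('n) / 2)) * u (inverse l *\<^sub>R x)) \<in> L2_space"
      "L2_norm (\<lambda>x. l powr (- (real CARD('n) / 2)) * u (inverse l *\<^sub>R x)) = L2_norm u"
      if "u \<in> L2_space"
      using L2_scaling[OF m that l] by auto
  next
    fix c x :: "real ^ 'n" and r :: real assume r: "r > 0" and x: "x \<noteq> c"
    show "log_laplacian_converges (kelvin_transform c r u) x"
      by (rule kelvin_transform_converges[OF m u(3) r x conv])
    show "satisfies_log_eq_at T (kelvin_transform c r u) x"
      by (rule kelvin_transform_satisfies_log_eq[OF m u(3) r x conv u(4)])
  qed
qed

end
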